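(* Let $q$ be a prime power, $n\in\mathbb{N}$, $r\in\{1,\dots,n-1\}$ and $\varepsilon\in(0,1)$. If $K\subset\mathbb{F}_q^n$ is an $\varepsilon$-Kakeya set of rank $r$, then $$|K| > \varepsilon\big(1+2(q-1)q^{-r}\big)^{-n} q^n,$$ and if moreover $r=1$, then also $$|K| > \varepsilon\,\frac{e^{-1}}{\log(2en)}\, 2^{-n} q^n .$$
   Context: $\mathbb{F}_q$ is the field with $q$ elements and $\mathrm{Gr}_{n,r}(\mathbb{F}_q)$ the set of $r$-dimensional linear subspaces of $\mathbb{F}_q^n$. For $\varepsilon\in(0,1]$, a set $K\subset\mathbb{F}_q^n$ is an $\varepsilon$-Kakeya set of rank $r$ if $|\{S\in\mathrm{Gr}_{n,r}(\mathbb{F}_q) : \exists x\in\mathbb{F}_q^n,\ x+S\subset K\}| \ge \varepsilon\, |\mathrm{Gr}_{n,r}(\mathbb{F}_q)|$. *)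

theory Defs
  imports "HOL-Analysis.Analysis"
begin

definition Gr :: "nat \<Rightarrow> ('a::{field,finite} ^ 'n) set set" where
  "Gr r = {S. vec.subspace S \<and> vec.dim S = r}"

definition eps_Kakeya :: "real \<Rightarrow> nat \<Rightarrow> ('a::{field,finite} ^ 'n) set \<Rightarrow> bool" where
  "eps_Kakeya \<epsilon> r K \<longleftrightarrow>
     real (card {S \<in> Gr r. \<exists>x. (\<lambda>v. x + v) ` S \<subseteq> K})
       \<ge> \<epsilon> * real (card (Gr r :: ('a ^ 'n) set set))"

end

theory Submission
  imports Defs "HOL-Library.Infinite_Typeclass"
begin

text \<open>The polynomial method with multiplicities bounds \<open>|K|\<close> when a fraction \<open>\<delta>\<close> of all directions is
  covered: \<open>|K| \<ge> (q / (1 + (q - 1) q\<^sup>-\<^sup>r / \<delta>))\<^sup>n\<close>. A nonzero polynomial vanishing to high order on \<open>K\<close>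
  vanishes to a smaller order \<open>l\<close> identically along every flat \<open>x + S \<subseteq> K\<close>, so its leading form vanishes
  to order \<open>l\<close> on the span of \<open>S\<close> over any extension of the field. Instead of an extension field of
  degree \<open>r\<close> we use the polynomial ring over \<open>F\<^sub>q\<close>, with its \<open>q\<^sup>r\<close> elements of degree less than \<open>r\<close> as
  the grid for the Schwartz-Zippel lemma. For small \<open>\<epsilon>\<close> this is applied to a union of
  \<open>t\<close> linear images of \<open>K\<close>, which can be chosen to miss at most a fraction \<open>(1 - \<epsilon>)\<^sup>t\<close> of the directions:
  \<open>t = \<lfloor>1/\<epsilon>\<rfloor>\<close> gives \<open>\<delta> > 1/2\<close> and the first bound, while \<open>t = \<lceil>ln ((n + 2) / 2) / \<epsilon>\<rceil>\<close> gives
  \<open>\<delta> > n / (n + 2)\<close> and the second.\<close>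

section \<open>Polynomial functions and vanishing orders\<close>

text \<open>Over a finite field, polynomial functions do not determine their coefficients. The
  polynomial ring over that field is an infinite domain, so it serves as the coefficient ring
  instead.\<close>

instance poly :: (zero_neq_one) infinite
proof
  have "inj (\<lambda>k. monom (1::'a) k)"
    by (rule injI) (metis coeff_monom zero_neq_one)
  then show "infinite (UNIV :: 'a poly set)"
    by (meson finite_subset infinite_UNIV_nat range_inj_infinite subset_UNIV)
qed

lemma poly_eqI_infinite:
  fixes p q :: "'b::{idom,infinite} poly"
  assumes "\<And>t. poly p t = poly q t"
  shows "p = q"
proof (rule ccontr)
  assume "p \<noteq> q"
  then have "finite {t. poly (p - q) t = 0}"
    by (intro poly_roots_finite) simp
  then show False
    using assms infinite_UNIV[where 'a='b] by simp
qed

text \<open>Polynomials are kept as functions with a certified bound \<open>d\<close> on the total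
  degree, which makes substitution a plain rule induction. The slack \<open>d + e \<le> k\<close> is
  what allows a bound to be weakened.\<close>

inductive polyfun :: "'i set \<Rightarrow> nat \<Rightarrow> (('i \<Rightarrow> 'b::comm_ring_1) \<Rightarrow> 'b) \<Rightarrow> bool"
  for I where
  const: "polyfun I d (\<lambda>_. c)"
| var: "i \<in> I \<Longrightarrow> 1 \<le> d \<Longrightarrow> polyfun I d (\<lambda>x. x i)"
| add: "polyfun I d f \<Longrightarrow> polyfun I d g \<Longrightarrow> polyfun I d (\<lambda>x. f x + g x)"
| mult: "polyfun I d f \<Longrightarrow> polyfun I e g \<Longrightarrow> d + e \<le> k \<Longrightarrow> polyfun I k (\<lambda>x. f x * g x)"

lemma polyfun_mono: "polyfun I d f \<Longrightarrow> d \<le> e \<Longrightarrow> polyfun I e f"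
  using polyfun.mult[of I d f 0 "\<lambda>_. 1" e] polyfun.const[of I 0 1] by simp

lemma polyfun_sum:
  assumes "\<And>a. a \<in> A \<Longrightarrow> polyfun I d (f a)"
  shows "polyfun I d (\<lambda>x. \<Sum>a\<in>A. f a x)"
  using assms by (induction A rule: infinite_finite_induct) (auto intro: polyfun.intros)

lemma polyfun_power: "polyfun I d f \<Longrightarrow> polyfun I (d * k) (\<lambda>x. f x ^ k)"
  by (induction k) (auto intro: polyfun.intros)

lemma polyfun_prod:
  assumes "\<And>a. a \<in> A \<Longrightarrow> polyfun I (d a) (f a)"
  shows "polyfun I (\<Sum>a\<in>A. d a) (\<lambda>x. \<Prod>a\<in>A. f a x)"
  using assms by (induction A rule: infinite_finite_induct) (auto intro: polyfun.const polyfun.mult[OF _ _ order_refl])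

lemma polyfun_cong_on: "polyfun I d f \<Longrightarrow> (\<And>i. i \<in> I \<Longrightarrow> x i = y i) \<Longrightarrow> f x = f y"
  by (induction rule: polyfun.induct) auto

text \<open>A polynomial in the variables \<open>I\<close> and one more variable, of total degree at most \<open>d\<close>.\<close>

definition graded_polyfun :: "'i set \<Rightarrow> nat \<Rightarrow> (('i \<Rightarrow> 'b::comm_ring_1) \<Rightarrow> 'b poly) \<Rightarrow> bool" where
  "graded_polyfun I d G \<longleftrightarrow>
     (\<forall>w. if w \<le> d then polyfun I (d - w) (\<lambda>y. coeff (G y) w) else (\<forall>y. coeff (G y) w = 0))"

lemma graded_polyfun_const: "graded_polyfun I d (\<lambda>_. [:c:])"
  by (auto simp: graded_polyfun_def coeff_pCons split: nat.splits intro: polyfun.const)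

lemma graded_polyfun_linear:
  assumes "polyfun I 1 f"
  shows "graded_polyfun I 1 (\<lambda>y. [:f y, c:])"
  using assms polyfun.const[of I 0]
  by (auto simp: graded_polyfun_def coeff_pCons le_Suc_eq split: nat.splits)

lemma graded_polyfun_add:
  assumes "graded_polyfun I d G" "graded_polyfun I d H"
  shows "graded_polyfun I d (\<lambda>y. G y + H y)"
  using assms by (auto simp: graded_polyfun_def intro: polyfun.add split: if_splits)

lemma graded_polyfun_mono:
  assumes "graded_polyfun I d G" "d \<le> e"
  shows "graded_polyfun I e G"
  unfolding graded_polyfun_def
proof (intro allI)
  fix w
  show "if w \<le> e then polyfun I (e - w) (\<lambda>y. coeff (G y) w) else (\<forall>y. coeff (G y) w = 0)"
  proof (cases "w \<le> d")
    case True
    then show ?thesis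
      using assms by (auto simp: graded_polyfun_def intro: polyfun_mono[of I "d - w"])
  next
    case False
    then have "\<forall>y. coeff (G y) w = 0"
      using assms(1) unfolding graded_polyfun_def by meson
    then show ?thesis by (simp add: polyfun.const)
  qed
qed

lemma graded_polyfun_mult:
  assumes "graded_polyfun I d G" "graded_polyfun I e H" "d + e \<le> k"
  shows "graded_polyfun I k (\<lambda>y. G y * H y)"
proof (rule graded_polyfun_mono[OF _ assms(3)], unfold graded_polyfun_def, intro allI)
  fix w
  \<comment> \<open>Each summand of the convolution either vanishes identically or has both indices
    in range; then \<open>d - i\<close> and \<open>e - (w - i)\<close> add up to
    \<open>d + e - w\<close>.\<close>
  have *: "(\<forall>y. coeff (G y) i * coeff (H y) (w - i) = 0) \<or>
           i \<le> d \<and> w - i \<le> e \<and> polyfun I (d - i) (\<lambda>y. coeff (G y) i) \<and>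
           polyfun I (e - (w - i)) (\<lambda>y. coeff (H y) (w - i))" for i
    using assms(1,2) unfolding graded_polyfun_def by (metis mult_zero_left mult_zero_right)
  have "polyfun I (d + e - w) (\<lambda>y. coeff (G y) i * coeff (H y) (w - i))"
    if "w \<le> d + e" "i \<le> w" for i
    using *[of i]
  proof
    assume "\<forall>y. coeff (G y) i * coeff (H y) (w - i) = 0"
    then show ?thesis by (simp add: polyfun.const)
  next
    assume "i \<le> d \<and> w - i \<le> e \<and> polyfun I (d - i) (\<lambda>y. coeff (G y) i) \<and>
           polyfun I (e - (w - i)) (\<lambda>y. coeff (H y) (w - i))"
    then show ?thesis
      using that by (intro polyfun.mult[of I "d - i" _ "e - (w - i)"]) auto
  qed
  moreover have "coeff (G y) i * coeff (H y) (w - i) = 0" if "\<not> w \<le> d + e" "i \<le> w" for i y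
    using *[of i] that by auto
  ultimately show "if w \<le> d + e then polyfun I (d + e - w) (\<lambda>y. coeff (G y * H y) w)
      else (\<forall>y. coeff (G y * H y) w = 0)"
    by (auto simp: coeff_mult intro!: polyfun_sum sum.neutral)
qed

text \<open>Replacing every variable by something of total degree at most 1 in \<open>y\<close> and
  \<open>t\<close> keeps the total degree. Restricting to a line, splitting off a variable and
  expanding around a flat are all instances.\<close>

lemma polyfun_subst:
  assumes "polyfun I d f" and X: "\<And>i. i \<in> I \<Longrightarrow> graded_polyfun J 1 (X i)"
  shows "\<exists>G. graded_polyfun J d G \<and> (\<forall>y t. poly (G y) t = f (\<lambda>i. poly (X i y) t))"
  using assms(1)
proof (induction rule: polyfun.induct)
  case (const d c)
  then show ?case by (intro exI[of _ "\<lambda>_. [:c:]"]) (simp add: graded_polyfun_const)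
next
  case (var i d)
  then show ?case by (intro exI[of _ "X i"]) (auto intro: graded_polyfun_mono[OF X])
next
  case (add d f g)
  then obtain G H where "graded_polyfun J d G" "\<forall>y t. poly (G y) t = f (\<lambda>i. poly (X i y) t)"
    "graded_polyfun J d H" "\<forall>y t. poly (H y) t = g (\<lambda>i. poly (X i y) t)" by blast
  then show ?case by (intro exI[of _ "\<lambda>y. G y + H y"]) (simp add: graded_polyfun_add)
next
  case (mult d f e g k)
  then obtain G H where "graded_polyfun J d G" "\<forall>y t. poly (G y) t = f (\<lambda>i. poly (X i y) t)"
    "graded_polyfun J e H" "\<forall>y t. poly (H y) t = g (\<lambda>i. poly (X i y) t)" by blast
  then show ?case
    using mult.hyps by (intro exI[of _ "\<lambda>y. G y * H y"]) (auto intro: graded_polyfun_mult)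
qed

lemma polyfun_line:
  assumes "polyfun I d f"
  shows "\<exists>p. \<forall>t. poly p t = f (\<lambda>i. a i + t * z i)"
proof -
  have "\<exists>G. graded_polyfun {} d G \<and> (\<forall>(y :: 'a \<Rightarrow> 'b) t. poly (G y) t = f (\<lambda>i. poly [:a i, z i:] t))"
    by (rule polyfun_subst[OF assms]) (rule graded_polyfun_linear, rule polyfun.const)
  then show ?thesis by auto
qed

text \<open>Vanishing to order \<open>m\<close>, tested on all lines through the point; over an infinite domain
  this is the vanishing of all Hasse derivatives of order less than \<open>m\<close>.\<close>

definition vanishes :: "nat \<Rightarrow> (('i \<Rightarrow> 'b::comm_ring_1) \<Rightarrow> 'b) \<Rightarrow> ('i \<Rightarrow> 'b) \<Rightarrow> bool" where
  "vanishes m f a \<longleftrightarrow>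
     (\<forall>z. \<exists>p. (\<forall>t. poly p t = f (\<lambda>i. a i + t * z i)) \<and> (\<forall>k<m. coeff p k = 0))"

text \<open>Over an infinite domain the expansion along a line is unique, so every expansion has the
  vanishing coefficients, not only the witness in the definition.\<close>

lemma vanishesD:
  fixes f :: "('i \<Rightarrow> 'b::{idom,infinite}) \<Rightarrow> 'b"
  assumes "vanishes m f a" "\<And>t. poly p t = f (\<lambda>i. a i + t * z i)" "k < m"
  shows "coeff p k = 0"
proof -
  obtain p' where "\<forall>t. poly p' t = f (\<lambda>i. a i + t * z i)" "\<forall>k<m. coeff p' k = 0"
    using assms(1) unfolding vanishes_def by blast
  moreover from this have "p = p'"
    using assms(2) by (intro poly_eqI_infinite) simp
  ultimately show ?thesis using assms(3) by simp
qed

text \<open>Directional vanishing controls all mixed coefficients: replacing \<open>t\<close> by \<open>\<sigma> \<tau>\<close> turns the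
  expansion into one along a single line, whose coefficients are polynomials in \<open>\<sigma>\<close>.\<close>

lemma vanishes_two_directions:
  fixes f :: "('i \<Rightarrow> 'b::{idom,infinite}) \<Rightarrow> 'b"
  assumes "vanishes m f a"
    and \<Phi>: "\<And>t \<tau>. poly (poly \<Phi> [:t:]) \<tau> = f (\<lambda>i. a i + t * y i + \<tau> * z i)"
    and "w + i < m"
  shows "coeff (coeff \<Phi> w) i = 0"
proof -
  define k where "k = w + i"
  \<comment> \<open>\<open>Q\<close> is the coefficient of \<open>\<tau> ^ k\<close> along the
    direction \<open>\<sigma> * y + z\<close>, viewed as a polynomial in \<open>\<sigma>\<close>.
    Its own coefficient at \<open>w\<close> is the mixed coefficient sought.\<close>
  define Q where "Q = (\<Sum>v\<le>degree \<Phi>. monom (if v \<le> k then coeff (coeff \<Phi> v) (k - v) else 0) v)"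
  have "poly Q \<sigma> = 0" for \<sigma>
  proof -
    define p where "p = (\<Sum>v\<le>degree \<Phi>. monom (\<sigma> ^ v) v * coeff \<Phi> v)"
    have "poly p \<tau> = f (\<lambda>i. a i + \<tau> * (\<sigma> * y i + z i))" for \<tau>
    proof -
      have "poly (poly \<Phi> [:\<tau> * \<sigma>:]) \<tau> = poly p \<tau>"
        unfolding p_def
        by (simp add: poly_altdef[of \<Phi>] poly_sum poly_monom power_mult_distrib mult_ac)
      then show ?thesis
        by (simp add: \<Phi> algebra_simps)
    qed
    then have "coeff p k = 0"
      using vanishesD[OF assms(1), of p "\<lambda>i. \<sigma> * y i + z i" k] assms(3) by (simp add: k_def)
    moreover have "coeff p k = poly Q \<sigma>"
      unfolding p_def Q_def coeff_sum poly_sum poly_monom coeff_monom_mult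
      by (intro sum.cong) (auto simp: mult_ac)
    ultimately show ?thesis by simp
  qed
  then have "Q = 0" by (intro poly_eqI_infinite) simp
  then have "coeff Q w = 0" by simp
  then show ?thesis
    by (cases "w \<le> degree \<Phi>") (simp_all add: Q_def coeff_sum k_def coeff_eq_0)
qed

section \<open>The Schwartz-Zippel lemma with multiplicities\<close>

lemma poly_altdef_le:
  fixes p :: "'b::comm_semiring_1 poly"
  shows "degree p \<le> d \<Longrightarrow> poly p t = (\<Sum>j\<le>d. coeff p j * t ^ j)"
  unfolding poly_altdef by (intro sum.mono_neutral_left) (auto simp: coeff_eq_0)

lemma degree_graded_polyfun:
  assumes "graded_polyfun I d G"
  shows "degree (G y) \<le> d"
proof (rule degree_le, intro allI impI)
  fix j assume "d < j"
  then show "coeff (G y) j = 0"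
    using assms unfolding graded_polyfun_def by (metis not_le)
qed

text \<open>Substituting a new variable for \<open>x i\<close> and keeping the other coordinates as
  parameters reads off the coefficients \<open>g j\<close>, with the right degree bounds.\<close>

lemma polyfun_split_var:
  assumes "polyfun (insert i I) d f"
  shows "\<exists>g. (\<forall>j\<le>d. polyfun I (d - j) (g j)) \<and> (\<forall>x. f x = (\<Sum>j\<le>d. x i ^ j * g j x))"
proof -
  define X :: "'a \<Rightarrow> ('a \<Rightarrow> 'b) \<Rightarrow> 'b poly" where
    "X = (\<lambda>k y. if k = i then [:0, 1:] else [:y k:])"
  have X: "graded_polyfun I 1 (X k)" if "k \<in> insert i I" for k
  proof (cases "k = i")
    case True
    then have "X k = (\<lambda>y. [:0, 1:])" by (simp add: X_def)
    then show ?thesis by (simp add: graded_polyfun_linear[unfolded One_nat_def] polyfun.const)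
  next
    case False
    then have "X k = (\<lambda>y. [:y k, 0:])" by (auto simp: X_def)
    then show ?thesis
      using False that
      by (simp only:) (intro graded_polyfun_linear polyfun.var, auto)
  qed
  from polyfun_subst[of "insert i I" d f I X, OF assms X] obtain G where G: "graded_polyfun I d G"
    "\<And>y t. poly (G y) t = f (\<lambda>k. poly (X k y) t)" by blast
  show ?thesis
  proof (intro exI[of _ "\<lambda>j y. coeff (G y) j"] conjI allI impI)
    show "polyfun I (d - j) (\<lambda>y. coeff (G y) j)" if "j \<le> d" for j
      using G(1) that by (auto simp: graded_polyfun_def split: if_splits)
    fix x
    have "(\<lambda>k. poly (X k x) (x i)) = x" by (auto simp: X_def)
    then have fx: "poly (G x) (x i) = f x" by (simp add: G(2))
    have "poly (G x) (x i) = (\<Sum>j\<le>d. coeff (G x) j * x i ^ j)"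
      by (rule poly_altdef_le[OF degree_graded_polyfun[OF G(1)]])
    then show "f x = (\<Sum>j\<le>d. x i ^ j * coeff (G x) j)"
      using fx by (simp add: mult.commute)
  qed
qed

lemma pcompose_monom: "pcompose (monom c n) q = smult c (q ^ n)"
  for q :: "'b::comm_ring_1 poly"
  by (induction n) (simp_all add: monom_0 monom_Suc pcompose_pCons)

text \<open>If the first \<open>c b\<close> Taylor coefficients at \<open>b\<close> vanish, then
  \<open>[:-b, 1:] ^ c b\<close> divides \<open>G\<close>; the orders of all roots together are at
  most the degree.\<close>

lemma sum_root_multiplicity_le_degree:
  fixes G :: "'b::idom poly"
  assumes "G \<noteq> 0" "finite B"
    and c: "\<And>b k. b \<in> B \<Longrightarrow> k < c b \<Longrightarrow> coeff (pcompose G [:b, 1:]) k = 0"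
  shows "(\<Sum>b\<in>B. c b) \<le> degree G"
proof -
  have "c b \<le> order b G" if "b \<in> B" for b
  proof -
    have "monom 1 (c b) dvd pcompose G [:b, 1:]"
      using c[OF that] by (simp add: monom_1_dvd_iff')
    then obtain H where "pcompose G [:b, 1:] = monom 1 (c b) * H" by (auto elim: dvdE)
    then have "pcompose (pcompose G [:b, 1:]) [:-b, 1:] = [:-b, 1:] ^ c b * pcompose H [:-b, 1:]"
      by (simp add: pcompose_mult pcompose_monom)
    moreover have "pcompose (pcompose G [:b, 1:]) [:-b, 1:] = G"
      by (simp add: pcompose_assoc[symmetric] pcompose_pCons)
    ultimately have "[:-b, 1:] ^ c b dvd G" by (metis dvd_triv_left)
    then show ?thesis using assms(1) by (simp add: order_divides)
  qed
  then have "(\<Sum>b\<in>B. c b) \<le> (\<Sum>b\<in>B. order b G)" by (rule sum_mono)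
  also have "\<dots> = (\<Sum>b\<in>{b\<in>B. poly G b = 0}. order b G)"
    using assms(2) by (intro sum.mono_neutral_right) (auto simp: order_root)
  also have "\<dots> \<le> (\<Sum>b | poly G b = 0. order b G)"
    using assms(1) by (intro sum_mono2) (auto simp: poly_roots_finite)
  also have "\<dots> \<le> degree G" by (rule sum_order_le_degree[OF assms(1)])
  finally show ?thesis .
qed

text \<open>On the line from \<open>a\<close> to a point where \<open>f\<close> is nonzero the
  expansion is nonzero. The exact order is the least index at which some line through
  \<open>a\<close> has a nonzero coefficient.\<close>

lemma exact_vanishing_order:
  fixes f :: "('i \<Rightarrow> 'b::{idom,infinite}) \<Rightarrow> 'b"
  assumes "polyfun I d f" "f x \<noteq> 0"
  shows "\<exists>m. vanishes m f a \<and>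
    (\<exists>z p. (\<forall>t. poly p t = f (\<lambda>i. a i + t * z i)) \<and> coeff p m \<noteq> 0)"
proof -
  define P where "P = (\<lambda>k. \<exists>z p. (\<forall>t. poly p t = f (\<lambda>i. a i + t * z i)) \<and> coeff p k \<noteq> 0)"
  obtain p where p: "\<And>t. poly p t = f (\<lambda>i. a i + t * (x i - a i))"
    using polyfun_line[OF assms(1), of a "\<lambda>i. x i - a i"] by blast
  from p[of 1] assms(2) have "p \<noteq> 0" by auto
  then have "P (degree p)" unfolding P_def using p
    by (intro exI[of _ "\<lambda>i. x i - a i"] exI[of _ p]) auto
  then have P: "P (Least P)" by (rule LeastI)
  have "vanishes (Least P) f a"
    unfolding vanishes_def
  proof
    fix z
    obtain q where q: "\<forall>t. poly q t = f (\<lambda>i. a i + t * z i)"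
      using polyfun_line[OF assms(1)] by blast
    then have "coeff q k = 0" if "k < Least P" for k
      using not_less_Least[OF that] unfolding P_def by blast
    with q show "\<exists>p. (\<forall>t. poly p t = f (\<lambda>i. a i + t * z i)) \<and> (\<forall>k<Least P. coeff p k = 0)"
      by blast
  qed
  with P show ?thesis unfolding P_def by blast
qed

text \<open>Induction on the variables. Let \<open>g t\<close> be the top nonzero coefficient of
  \<open>f\<close> in \<open>x i\<close> and \<open>m a\<close> its exact order at \<open>a\<close>:
  the orders of \<open>f\<close> on the fibre over \<open>a\<close> sum to at most
  \<open>card S * m a + t\<close>, and the induction hypothesis for \<open>g t\<close>, of degree at
  most \<open>d - t\<close>, bounds the sum of the \<open>m a\<close>.\<close>

theorem schwartz_zippel_multiplicity:
  fixes f :: "('i \<Rightarrow> 'b::{idom,infinite}) \<Rightarrow> 'b"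
  assumes "finite I" "finite S" "polyfun I d f" "f x \<noteq> 0"
    and "\<And>a. a \<in> PiE I (\<lambda>_. S) \<Longrightarrow> vanishes (\<mu> a) f a"
  shows "card S * (\<Sum>a\<in>PiE I (\<lambda>_. S). \<mu> a) \<le> d * card S ^ card I"
  using assms(1,3-)
proof (induction I arbitrary: d f x \<mu> rule: finite_induct)
  case empty
  \<comment> \<open>Without variables \<open>f\<close> is a nonzero constant, which has no positive
    vanishing order; the grid is the single point \<open>a\<close>.\<close>
  define a :: "'i \<Rightarrow> 'b" where "a = (\<lambda>_. undefined)"
  have "\<mu> a = 0"
  proof (rule ccontr)
    assume "\<mu> a \<noteq> 0"
    have "vanishes (\<mu> a) f a" using empty.prems by (auto simp: a_def)
    moreover obtain p where p: "\<And>t. poly p t = f (\<lambda>i. a i + t * 0)"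
      using polyfun_line[OF empty.prems(1), of a "\<lambda>_. 0"] by auto
    ultimately have "coeff p 0 = 0"
      using \<open>\<mu> a \<noteq> 0\<close> by (intro vanishesD[where f = f and a = a and z = "\<lambda>_. 0" and m = "\<mu> a"]) auto
    then have "f a = 0" using p[of 0] by (simp add: poly_0_coeff_0)
    moreover have "f a = f x" by (rule polyfun_cong_on[OF empty.prems(1)]) auto
    ultimately show False using empty.prems(2) by simp
  qed
  then show ?case by (simp add: a_def)
next
  case (insert i I)
  let ?s = "card S" and ?P = "PiE I (\<lambda>_. S)"
  obtain g where g: "\<And>j. j \<le> d \<Longrightarrow> polyfun I (d - j) (g j)"
    and f: "\<And>x. f x = (\<Sum>j\<le>d. x i ^ j * g j x)"
    using polyfun_split_var[OF insert.prems(1)] by blast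
  define J where "J = {j. j \<le> d \<and> (\<exists>x. g j x \<noteq> 0)}"
  have "finite J" by (simp add: J_def)
  have "J \<noteq> {}"
  proof
    assume "J = {}"
    then have "f x = 0" unfolding f J_def by (intro sum.neutral) auto
    with insert.prems(2) show False by simp
  qed
  define t where "t = Max J"
  have "t \<in> J" using \<open>finite J\<close> \<open>J \<noteq> {}\<close> by (simp add: t_def)
  then obtain x' where t: "t \<le> d" "g t x' \<noteq> 0" by (auto simp: J_def)
  have gt: "g j x = 0" if "t < j" "j \<le> d" for j x
    using that Max_ge[OF \<open>finite J\<close>, of j] unfolding t_def by (fastforce simp: J_def)
  have f': "f x = (\<Sum>j\<le>t. x i ^ j * g j x)" for x
    unfolding f using t(1) gt by (intro sum.mono_neutral_right) auto
  have "\<forall>a. \<exists>m. vanishes m (g t) a \<and>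
      (\<exists>z p. (\<forall>\<tau>. poly p \<tau> = g t (\<lambda>k. a k + \<tau> * z k)) \<and> coeff p m \<noteq> 0)"
    by (intro allI exact_vanishing_order[where f = "g t" and x = x', OF g[OF t(1)] t(2)])
  from choice[OF this] obtain m where m: "\<And>a. vanishes (m a) (g t) a"
    and m_exact: "\<And>a. \<exists>z p. (\<forall>\<tau>. poly p \<tau> = g t (\<lambda>k. a k + \<tau> * z k)) \<and> coeff p (m a) \<noteq> 0"
    by blast
  have IH: "?s * (\<Sum>a\<in>?P. m a) \<le> (d - t) * ?s ^ card I"
    by (rule insert.IH[where f = "g t" and x = x' and \<mu> = m, OF g[OF t(1)] t(2) m])
  have fibre: "(\<Sum>b\<in>S. \<mu> (a(i := b))) \<le> ?s * m a + t" if a: "a \<in> ?P" for a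
  proof -
    obtain z q where q: "\<And>\<tau>. poly q \<tau> = g t (\<lambda>k. a k + \<tau> * z k)" "coeff q (m a) \<noteq> 0"
      using m_exact[of a] by blast
    have "\<exists>p. \<forall>\<tau>. poly p \<tau> = g j (\<lambda>k. a k + \<tau> * z k)" if "j \<le> t" for j
      using polyfun_line[OF g] that t(1) by (meson le_trans)
    then obtain p where p: "\<And>j \<tau>. j \<le> t \<Longrightarrow> poly (p j) \<tau> = g j (\<lambda>k. a k + \<tau> * z k)"
      by metis
    have "p t = q" by (intro poly_eqI_infinite) (simp add: p q)
    \<comment> \<open>\<open>G\<close> is the coefficient of \<open>\<tau> ^ m a\<close> of
      \<open>f\<close> along \<open>z\<close> in the other coordinates, as a polynomial in the value
      of \<open>x i\<close>. The choice of \<open>z\<close> makes its coefficient at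
      \<open>t\<close> nonzero.\<close>
    define G where "G = (\<Sum>j\<le>t. monom (coeff (p j) (m a)) j)"
    have coeff_G: "coeff G t \<noteq> 0"
      using q(2) by (simp add: G_def coeff_sum \<open>p t = q\<close>)
    have deg_G: "degree G \<le> t"
      unfolding G_def by (intro degree_sum_le) (auto intro: order_trans[OF degree_monom_le])
    have "(\<Sum>b\<in>S. \<mu> (a(i := b)) - m a) \<le> degree G"
    proof (rule sum_root_multiplicity_le_degree)
      show "G \<noteq> 0" using coeff_G by auto
      show "finite S" by fact
      fix b k assume b: "b \<in> S" and k: "k < \<mu> (a(i := b)) - m a"
      \<comment> \<open>The expansion of \<open>f\<close> around \<open>a(i := b)\<close>, with one
        variable moving coordinate \<open>i\<close> and the other moving along \<open>z\<close>. Its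
        mixed coefficients vanish at total order below \<open>\<mu> (a(i := b))\<close>, so
        \<open>G\<close> vanishes at \<open>b\<close> to order at least
        \<open>\<mu> (a(i := b)) - m a\<close>.\<close>
      define \<Phi> where "\<Phi> = (\<Sum>j\<le>t. [:[:b:], 1:] ^ j * [:p j:])"
      have "poly (poly \<Phi> [:u:]) \<tau> =
          f (\<lambda>l. (a(i := b)) l + u * (if l = i then 1 else 0) + \<tau> * (z(i := 0)) l)" for u \<tau>
      proof -
        have "g j (\<lambda>k. a k + \<tau> * z k) =
            g j (\<lambda>l. (a(i := b)) l + u * (if l = i then 1 else 0) + \<tau> * (z(i := 0)) l)"
          if "j \<le> t" for j
          using that t(1) insert.hyps by (intro polyfun_cong_on[OF g]) auto
        then show ?thesis
          unfolding f' \<Phi>_def by (simp add: poly_sum p mult.commute)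
      qed
      moreover have "vanishes (\<mu> (a(i := b))) f (a(i := b))"
        using a b insert.hyps by (intro insert.prems(3)) (auto simp: PiE_iff extensional_def)
      ultimately have "coeff (coeff \<Phi> k) (m a) = 0"
        using k by (intro vanishes_two_directions[of "\<mu> (a(i := b))" f "a(i := b)" \<Phi>]) auto
      moreover have "coeff (coeff \<Phi> k) (m a) = coeff (pcompose G [:b, 1:]) k"
      proof -
        have "coeff (coeff ([:[:b:], 1:] ^ j * [:r:]) k) l =
            coeff r l * coeff ([:b, 1:] ^ j) k" for j r l
        proof -
          have "[:[:b:], 1:] ^ j = map_poly (\<lambda>c. [:c:]) ([:b, 1:] ^ j)"
            by (induction j) (simp_all add: poly_eq_iff coeff_map_poly coeff_pCons mult.commute
                split: nat.splits)
          then have "coeff ([:[:b:], 1:] ^ j) k = [:coeff ([:b, 1:] ^ j) k:]"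
            by (simp add: coeff_map_poly)
          then show ?thesis by (simp add: mult.commute)
        qed
        then show ?thesis
          unfolding \<Phi>_def G_def
          by (simp add: coeff_sum pcompose_sum pcompose_monom)
      qed
      ultimately show "coeff (pcompose G [:b, 1:]) k = 0" by simp
    qed
    \<comment> \<open>Subtraction is truncated, so points with
      \<open>\<mu> (a(i := b)) < m a\<close> are covered as well.\<close>
    moreover have "(\<Sum>b\<in>S. \<mu> (a(i := b))) \<le> (\<Sum>b\<in>S. m a + (\<mu> (a(i := b)) - m a))"
      by (intro sum_mono) auto
    ultimately show ?thesis using deg_G by (simp add: sum.distrib)
  qed
  have "(\<Sum>a\<in>PiE (insert i I) (\<lambda>_. S). \<mu> a) = (\<Sum>a\<in>?P. \<Sum>b\<in>S. \<mu> (a(i := b)))"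
  proof -
    have "bij_betw (\<lambda>(b, a). a(i := b)) (S \<times> ?P) (PiE (insert i I) (\<lambda>_. S))"
      unfolding bij_betw_def PiE_insert_eq using insert.hyps by (auto intro!: inj_combinator)
    then have "(\<Sum>a\<in>PiE (insert i I) (\<lambda>_. S). \<mu> a) = (\<Sum>(b, a)\<in>S \<times> ?P. \<mu> (a(i := b)))"
      by (subst sum.reindex_bij_betw[symmetric]) (auto simp: case_prod_unfold)
    also have "\<dots> = (\<Sum>a\<in>?P. \<Sum>b\<in>S. \<mu> (a(i := b)))"
      by (subst sum.cartesian_product[symmetric], subst sum.swap) simp
    finally show ?thesis .
  qed
  also have "\<dots> \<le> (\<Sum>a\<in>?P. ?s * m a + t)"
    by (intro sum_mono fibre)
  also have "\<dots> = ?s * (\<Sum>a\<in>?P. m a) + t * ?s ^ card I"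
    using insert.hyps by (simp add: sum.distrib sum_distrib_left card_PiE)
  also have "\<dots> \<le> (d - t) * ?s ^ card I + t * ?s ^ card I"
    using IH by simp
  also have "\<dots> = d * ?s ^ card I"
    using t(1) by (simp add: add_mult_distrib[symmetric])
  finally have "?s * (\<Sum>a\<in>PiE (insert i I) (\<lambda>_. S). \<mu> a) \<le> ?s * (d * ?s ^ card I)"
    by (rule mult_le_mono2)
  then show ?case using insert.hyps by (simp add: mult_ac)
qed

section \<open>Vanishing on flats and leading forms\<close>

text \<open>In the expansion along \<open>z\<close> from a point of the flat, the coefficient of
  \<open>t ^ w\<close> is a polynomial in the parameters \<open>u\<close> of degree at most
  \<open>d - w\<close>, vanishing to order \<open>m - w\<close> on the grid. For
  \<open>w < l\<close> this is too much for a nonzero polynomial, so it vanishes for all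
  \<open>u\<close> in the ring, not only on the grid.\<close>

theorem vanishes_on_flat:
  fixes f :: "('i \<Rightarrow> 'b::{idom,infinite}) \<Rightarrow> 'b"
  assumes f: "polyfun I d f" and "finite K" "finite S" "card S \<ge> 2"
    and van: "\<And>u. u \<in> PiE K (\<lambda>_. S) \<Longrightarrow> vanishes m f (\<lambda>i. x i + (\<Sum>k\<in>K. u k * s k i))"
    and le: "d + (card S - 1) * l \<le> card S * m"
  shows "vanishes l f (\<lambda>i. x i + (\<Sum>k\<in>K. u k * s k i))"
  unfolding vanishes_def
proof
  fix z :: "'i \<Rightarrow> 'b"
  have "polyfun K 1 (\<lambda>u. x i + (\<Sum>k\<in>K. u k * s k i))" for i
    by (intro polyfun.add polyfun.const polyfun_sum polyfun.mult[of K 1 _ 0] polyfun.var) auto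
  then have X: "graded_polyfun K 1 (\<lambda>u. [:x i + (\<Sum>k\<in>K. u k * s k i), z i:])" for i
    by (rule graded_polyfun_linear)
  from polyfun_subst[where X = "\<lambda>i u. [:x i + (\<Sum>k\<in>K. u k * s k i), z i:]" and J = K, OF f X]
  obtain Q where Q: "graded_polyfun K d Q"
    and Q_eq: "\<And>u t. poly (Q u) t = f (\<lambda>i. x i + (\<Sum>k\<in>K. u k * s k i) + t * z i)"
    by auto
  have pf: "polyfun K (d - v) (\<lambda>u. coeff (Q u) v)" if "v \<le> d" for v
    using Q that unfolding graded_polyfun_def by meson
  have "coeff (Q u) w = 0" if "w < l" for w
  proof (rule ccontr)
    assume nz: "coeff (Q u) w \<noteq> 0"
    with degree_graded_polyfun[OF Q] have w: "w \<le> d"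
      by (meson le_degree le_trans)
    have "vanishes (m - w) (\<lambda>u. coeff (Q u) w) u'" if u': "u' \<in> PiE K (\<lambda>_. S)" for u'
      unfolding vanishes_def
    proof
      fix \<zeta> :: "'a \<Rightarrow> 'b"
      have "\<exists>p. \<forall>\<tau>. poly p \<tau> = coeff (Q (\<lambda>k. u' k + \<tau> * \<zeta> k)) v" if "v \<le> d" for v
        using polyfun_line[OF pf[OF that]] by blast
      then obtain p where p: "\<And>v \<tau>. v \<le> d \<Longrightarrow> poly (p v) \<tau> = coeff (Q (\<lambda>k. u' k + \<tau> * \<zeta> k)) v"
        by metis
      \<comment> \<open>One variable moves off the flat along \<open>z\<close>, the other within it
        along \<open>\<zeta>\<close>.\<close>
      define \<Phi> where "\<Phi> = (\<Sum>v\<le>d. monom (p v) v)"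
      have "poly (poly \<Phi> [:t:]) \<tau> =
          f (\<lambda>i. x i + (\<Sum>k\<in>K. u' k * s k i) + t * z i + \<tau> * (\<Sum>k\<in>K. \<zeta> k * s k i))" for t \<tau>
      proof -
        have "poly (poly \<Phi> [:t:]) \<tau> = poly (Q (\<lambda>k. u' k + \<tau> * \<zeta> k)) t"
          unfolding \<Phi>_def poly_altdef_le[OF degree_graded_polyfun[OF Q]]
          by (simp add: poly_sum poly_monom p)
        then show ?thesis
          by (simp add: Q_eq algebra_simps sum.distrib sum_distrib_left)
      qed
      then have "coeff (coeff \<Phi> w) i = 0" if "i < m - w" for i
        using that by (intro vanishes_two_directions[OF van[OF u']]) auto
      moreover have "coeff \<Phi> w = p w"
        using w by (simp add: \<Phi>_def coeff_sum)
      ultimately show "\<exists>p. (\<forall>t. poly p t = coeff (Q (\<lambda>i. u' i + t * \<zeta> i)) w) \<and>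
          (\<forall>k<m - w. coeff p k = 0)"
        using p[OF w] by auto
    qed
    from schwartz_zippel_multiplicity[where \<mu> = "\<lambda>_. m - w", OF \<open>finite K\<close> \<open>finite S\<close> pf[OF w] nz this]
    have "card S * (card S ^ card K * (m - w)) \<le> (d - w) * card S ^ card K"
      using \<open>finite K\<close> by (simp add: card_PiE)
    then have "card S ^ card K * (card S * (m - w)) \<le> card S ^ card K * (d - w)"
      by (simp only: mult_ac)
    then have A: "card S * (m - w) \<le> d - w"
      using \<open>card S \<ge> 2\<close> by simp
    obtain c where c: "card S = Suc (Suc c)"
      using \<open>card S \<ge> 2\<close> by (metis add_2_eq_Suc le_Suc_ex)
    have "Suc c * w < Suc c * l" using \<open>w < l\<close> by (intro mult_less_mono2) auto
    moreover have "Suc (Suc c) * (m - w) = Suc (Suc c) * m - Suc (Suc c) * w"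
      by (rule diff_mult_distrib2)
    \<comment> \<open>For \<open>m < w\<close> the truncated difference makes \<open>A\<close>
      trivial; there the contradiction comes from \<open>le\<close>, \<open>w \<le> d\<close> and
      \<open>w < l\<close>.\<close>
    moreover have "m < w \<Longrightarrow> Suc c * m \<le> Suc c * w" by (intro mult_le_mono2) auto
    ultimately show False
      using A le w \<open>w < l\<close> unfolding c by auto
  qed
  then show "\<exists>p. (\<forall>t. poly p t = f (\<lambda>i. x i + (\<Sum>k\<in>K. u k * s k i) + t * z i)) \<and>
      (\<forall>k<l. coeff p k = 0)"
    using Q_eq by blast
qed

section \<open>Polynomials with explicit coefficients and their leading forms\<close>

definition mpoly_eval ::
    "('i::finite \<Rightarrow> nat) set \<Rightarrow> (('i \<Rightarrow> nat) \<Rightarrow> 'b::comm_ring_1) \<Rightarrow> ('i \<Rightarrow> 'b) \<Rightarrow> 'b" where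
  "mpoly_eval E c x = (\<Sum>e\<in>E. c e * (\<Prod>i\<in>UNIV. x i ^ e i))"

lemma polyfun_mpoly_eval:
  assumes "\<And>e. e \<in> E \<Longrightarrow> sum e UNIV \<le> d"
  shows "polyfun UNIV d (mpoly_eval E c)"
proof -
  have "polyfun UNIV d (\<lambda>x. c e * (\<Prod>i\<in>UNIV. x i ^ e i))" if "e \<in> E" for e
  proof (rule polyfun.mult[of _ 0])
    show "polyfun UNIV (sum e UNIV) (\<lambda>x. \<Prod>i\<in>UNIV. x i ^ e i)"
      using polyfun_power[OF polyfun.var[of _ UNIV 1]] by (intro polyfun_prod) simp
  qed (use assms[OF that] in \<open>auto intro: polyfun.const\<close>)
  then show ?thesis
    unfolding mpoly_eval_def[abs_def] by (rule polyfun_sum)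
qed

lemma coeff_mult_top:
  assumes "degree p \<le> m" "degree q \<le> n"
  shows "coeff (p * q) (m + n) = coeff p m * coeff q n"
proof (cases "degree p = m \<and> degree q = n")
  case True
  then show ?thesis by (auto simp: coeff_mult_degree_sum)
next
  case False
  then have "degree (p * q) < m + n"
    using assms degree_mult_le[of p q] by linarith
  then show ?thesis
    using False assms by (auto simp: coeff_eq_0)
qed

lemma coeff_power_top:
  fixes p :: "'b::comm_ring_1 poly"
  assumes "degree p \<le> m"
  shows "coeff (p ^ n) (m * n) = coeff p m ^ n"
proof (induction n)
  case (Suc n)
  have "degree (p ^ n) \<le> m * n"
    using degree_power_le[of p n] assms by (meson le_trans mult_le_mono1)
  then show ?case
    using Suc coeff_mult_top[OF assms, of "p ^ n" "m * n"] by simp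
qed auto

text \<open>The top coefficient of a monomial evaluated at the linear polynomials
  \<open>[:p i, r i:]\<close> is the monomial at \<open>r\<close>; this is how a leading form is
  extracted.\<close>

lemma prod_linear_power_top:
  fixes p r :: "'i \<Rightarrow> 'b::comm_ring_1"
  shows "degree (\<Prod>i\<in>A. [:p i, r i:] ^ e i) \<le> sum e A \<and>
    coeff (\<Prod>i\<in>A. [:p i, r i:] ^ e i) (sum e A) = (\<Prod>i\<in>A. r i ^ e i)"
proof (induction A rule: infinite_finite_induct)
  case (insert a A)
  have "degree ([:p a, r a:] ^ e a) \<le> e a"
    using degree_power_le[of "[:p a, r a:]" "e a"] by (rule order_trans) simp
  moreover have "coeff ([:p a, r a:] ^ e a) (e a) = r a ^ e a"
    using coeff_power_top[of "[:p a, r a:]" 1 "e a"] by simp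
  ultimately show ?case
    using insert coeff_mult_top[of "[:p a, r a:] ^ e a" "e a" "\<Prod>i\<in>A. [:p i, r i:] ^ e i" "sum e A"]
      degree_mult_le[of "[:p a, r a:] ^ e a" "\<Prod>i\<in>A. [:p i, r i:] ^ e i"]
    by auto
qed auto

lemma poly_map_poly_coeff:
  "poly (map_poly (\<lambda>p. coeff p i) \<Phi>) y = coeff (poly \<Phi> [:y:]) i"
  by (induction \<Phi>) (simp_all add: map_poly_pCons)

theorem vanishes_leading_form:
  fixes x v :: "'i::finite \<Rightarrow> 'b::{idom,infinite}"
  assumes "finite E" and deg: "\<And>e. e \<in> E \<Longrightarrow> sum e UNIV \<le> d"
    and van: "\<And>y. vanishes l (mpoly_eval E c) (\<lambda>i. x i + y * v i)"
  shows "vanishes l (mpoly_eval {e \<in> E. sum e UNIV = d} c) v"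
  unfolding vanishes_def
proof
  fix z :: "'i \<Rightarrow> 'b"
  define T where "T = (\<lambda>e. \<Prod>i\<in>UNIV. [:[:x i:], [:v i, z i:]:] ^ e i)"
  have T: "degree (T e) \<le> sum e UNIV" "coeff (T e) (sum e UNIV) = (\<Prod>i\<in>UNIV. [:v i, z i:] ^ e i)"
    for e
    using prod_linear_power_top[of "\<lambda>i. [:x i:]" "\<lambda>i. [:v i, z i:]" e UNIV] by (auto simp: T_def)
  define \<Phi> where "\<Phi> = (\<Sum>e\<in>E. smult [:c e:] (T e))"
  \<comment> \<open>The direction is scaled by \<open>y\<close>, so the argument is
    \<open>x + y * (v + t * z)\<close> and the coefficient of \<open>y ^ d\<close> is the leading
    form at \<open>v + t * z\<close>.\<close>
  have "poly (poly \<Phi> [:y:]) t = mpoly_eval E c (\<lambda>i. (x i + y * v i) + t * (y * z i))" for y t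
    unfolding \<Phi>_def mpoly_eval_def T_def
    by (simp add: poly_sum poly_prod poly_power algebra_simps)
  then have "coeff (poly \<Phi> [:y:]) i = 0" if "i < l" for y i
    using that by (intro vanishesD[OF van[of y]]) auto
  \<comment> \<open>For fixed \<open>i < l\<close> the coefficient of \<open>t ^ i\<close> is a
    polynomial in \<open>y\<close> that vanishes at every \<open>y\<close>, hence is zero, and so is
    its coefficient at \<open>y ^ d\<close>.\<close>
  then have "map_poly (\<lambda>p. coeff p i) \<Phi> = 0" if "i < l" for i
    using that by (intro poly_eqI_infinite) (simp add: poly_map_poly_coeff)
  then have *: "coeff (coeff \<Phi> d) i = 0" if "i < l" for i
    using that by (metis coeff_0 coeff_map_poly)
  have "coeff \<Phi> d = (\<Sum>e\<in>E. [:c e:] * coeff (T e) d)"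
    by (simp add: \<Phi>_def coeff_sum)
  also have "\<dots> = (\<Sum>e\<in>{e \<in> E. sum e UNIV = d}. [:c e:] * coeff (T e) d)"
  proof (intro sum.mono_neutral_right \<open>finite E\<close> ballI)
    fix e assume "e \<in> E - {e \<in> E. sum e UNIV = d}"
    then have "degree (T e) < d" using T(1)[of e] deg[of e] by auto
    then show "[:c e:] * coeff (T e) d = 0" by (simp add: coeff_eq_0)
  qed auto
  also have "\<dots> = (\<Sum>e\<in>{e \<in> E. sum e UNIV = d}. [:c e:] * (\<Prod>i\<in>UNIV. [:v i, z i:] ^ e i))"
    using T(2) by (intro sum.cong) auto
  finally have "poly (coeff \<Phi> d) t = mpoly_eval {e \<in> E. sum e UNIV = d} c (\<lambda>i. v i + t * z i)" for t
    by (simp add: mpoly_eval_def poly_sum poly_prod poly_power)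
  with * show "\<exists>p. (\<forall>t. poly p t = mpoly_eval {e \<in> E. sum e UNIV = d} c (\<lambda>i. v i + t * z i)) \<and>
      (\<forall>k<l. coeff p k = 0)"
    by blast
qed

section \<open>Existence of a vanishing polynomial\<close>

text \<open>Pigeonhole: there are more assignments to the unknowns than value vectors of the
  equations. Two assignments with the same values differ by a nontrivial solution.\<close>

lemma homogeneous_system_solution:
  fixes M :: "'y \<Rightarrow> 'x \<Rightarrow> 'a::{field,finite}"
  assumes "finite X" "finite Y" "card Y < card X"
  shows "\<exists>c. (\<exists>x\<in>X. c x \<noteq> 0) \<and> (\<forall>y\<in>Y. (\<Sum>x\<in>X. M y x * c x) = 0)"
proof -
  define \<phi> where "\<phi> = (\<lambda>c. \<lambda>y\<in>Y. \<Sum>x\<in>X. M y x * c x)"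
  have "card {0, 1 :: 'a} \<le> CARD('a)" by (intro card_mono) auto
  then have "CARD('a) ^ card Y < CARD('a) ^ card X"
    using assms(3) by (intro power_strict_increasing) auto
  then have "card (PiE Y (\<lambda>_. UNIV :: 'a set)) < card (PiE X (\<lambda>_. UNIV :: 'a set))"
    using assms by (simp add: card_PiE)
  moreover have "\<phi> ` PiE X (\<lambda>_. UNIV) \<subseteq> PiE Y (\<lambda>_. UNIV)"
    by (auto simp: \<phi>_def)
  ultimately have "\<not> inj_on \<phi> (PiE X (\<lambda>_. UNIV))"
    using card_inj_on_le[of \<phi>] assms(2) by (metis finite_PiE finite not_less)
  then obtain c c' where c: "c \<in> PiE X (\<lambda>_. UNIV)" "c' \<in> PiE X (\<lambda>_. UNIV)" "\<phi> c = \<phi> c'" "c \<noteq> c'"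
    unfolding inj_on_def by blast
  show ?thesis
  proof (intro exI[of _ "\<lambda>x. c x - c' x"] conjI ballI)
    show "\<exists>x\<in>X. c x - c' x \<noteq> 0"
      using c PiE_ext[OF c(1,2)] by auto
    fix y assume "y \<in> Y"
    then show "(\<Sum>x\<in>X. M y x * (c x - c' x)) = 0"
      using fun_cong[OF c(3), of y] by (simp add: \<phi>_def right_diff_distrib sum_subtractf)
  qed
qed

text \<open>The Hasse derivative with index \<open>k\<close> at \<open>a\<close>, that is, the
  coefficient of the monomial with exponents \<open>k\<close> in the expansion around
  \<open>a\<close>. Binomial coefficients in place of iterated derivatives keep it meaningful in
  positive characteristic.\<close>

definition hasse ::
    "('i::finite \<Rightarrow> nat) set \<Rightarrow> (('i \<Rightarrow> nat) \<Rightarrow> 'b::comm_ring_1) \<Rightarrow> ('i \<Rightarrow> 'b) \<Rightarrow> ('i \<Rightarrow> nat) \<Rightarrow> 'b" where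
  "hasse E c a k = (\<Sum>e\<in>E. c e * (\<Prod>i\<in>UNIV. of_nat (e i choose k i) * a i ^ (e i - k i)))"

lemma vanishes_if_hasse_zero:
  assumes "finite E" and zero: "\<And>k. sum k UNIV < m \<Longrightarrow> hasse E c a k = 0"
  shows "vanishes m (mpoly_eval E c) a"
  unfolding vanishes_def
proof
  fix z
  \<comment> \<open>A common bound for all exponents lets the binomial expansions of all monomials
    range over the same box \<open>B\<close>.\<close>
  define N where "N = (\<Sum>e\<in>E. sum e UNIV)"
  have N: "e i \<le> N" if "e \<in> E" for e i
  proof -
    have "e i \<le> sum e UNIV" by (rule member_le_sum) auto
    also have "\<dots> \<le> N" unfolding N_def using assms(1) that by (intro member_le_sum) auto
    finally show ?thesis .
  qed
  define B where "B = PiE UNIV (\<lambda>_ :: 'a. {..N})"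
  define p where "p = (\<Sum>k\<in>B. monom (hasse E c a k * (\<Prod>i\<in>UNIV. z i ^ k i)) (sum k UNIV))"
  have *: "(\<Prod>i\<in>UNIV. (a i + t * z i) ^ e i) =
      (\<Sum>k\<in>B. t ^ sum k UNIV * (\<Prod>i\<in>UNIV. z i ^ k i) *
        (\<Prod>i\<in>UNIV. of_nat (e i choose k i) * a i ^ (e i - k i)))" if "e \<in> E" for e t
  proof -
    have "(a i + t * z i) ^ e i =
        (\<Sum>k\<le>N. t ^ k * z i ^ k * (of_nat (e i choose k) * a i ^ (e i - k)))" for i
    proof -
      have "(a i + t * z i) ^ e i = (t * z i + a i) ^ e i" by (simp add: add.commute)
      also have "\<dots> = (\<Sum>k\<le>e i. of_nat (e i choose k) * (t * z i) ^ k * a i ^ (e i - k))"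
        by (rule binomial_ring)
      also have "\<dots> = (\<Sum>k\<le>N. of_nat (e i choose k) * (t * z i) ^ k * a i ^ (e i - k))"
        using N[OF that] by (intro sum.mono_neutral_left) (auto simp: binomial_eq_0 not_le)
      finally show ?thesis by (simp add: power_mult_distrib mult_ac)
    qed
    then have "(\<Prod>i\<in>UNIV. (a i + t * z i) ^ e i) =
        (\<Prod>i\<in>UNIV. \<Sum>k\<le>N. t ^ k * z i ^ k * (of_nat (e i choose k) * a i ^ (e i - k)))"
      by simp
    also have "\<dots> = (\<Sum>k\<in>B. \<Prod>i\<in>UNIV. t ^ k i * z i ^ k i * (of_nat (e i choose k i) * a i ^ (e i - k i)))"
      unfolding B_def by (rule prod_sum_PiE) auto
    finally show ?thesis by (simp add: prod.distrib power_sum)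
  qed
  have "poly p t = mpoly_eval E c (\<lambda>i. a i + t * z i)" for t
  proof -
    have "mpoly_eval E c (\<lambda>i. a i + t * z i) =
        (\<Sum>e\<in>E. \<Sum>k\<in>B. c e * (t ^ sum k UNIV * (\<Prod>i\<in>UNIV. z i ^ k i) *
        (\<Prod>i\<in>UNIV. of_nat (e i choose k i) * a i ^ (e i - k i))))"
      unfolding mpoly_eval_def by (intro sum.cong) (simp_all only: * sum_distrib_left)
    also have "\<dots> = poly p t"
      unfolding p_def hasse_def
      unfolding poly_sum poly_monom sum_distrib_right
      by (subst sum.swap) (intro sum.cong refl, simp only: mult_ac)
    finally show ?thesis by simp
  qed
  moreover have "coeff p j = 0" if "j < m" for j
    unfolding p_def coeff_sum using that by (intro sum.neutral) (auto simp: zero)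
  ultimately show "\<exists>p. (\<forall>t. poly p t = mpoly_eval E c (\<lambda>i. a i + t * z i)) \<and> (\<forall>k<m. coeff p k = 0)"
    by blast
qed

lemma finite_bounded_exponents: "finite {e :: 'i::finite \<Rightarrow> nat. sum e UNIV < d}"
proof (rule finite_subset)
  show "{e :: 'i \<Rightarrow> nat. sum e UNIV < d} \<subseteq> PiE UNIV (\<lambda>_. {..<d})"
  proof (intro subsetI PiE_I)
    fix e :: "'i \<Rightarrow> nat" and i
    assume "e \<in> {e. sum e UNIV < d}"
    then show "e i \<in> {..<d}"
      using member_le_sum[of i UNIV e] by simp
  qed simp
qed (simp add: finite_PiE)

lemma hasse_const_poly:
  "hasse E (\<lambda>e. [:c e:]) (\<lambda>i. [:a i:]) k = [:hasse E c a k:]"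
  for a :: "'i::finite \<Rightarrow> 'b::comm_ring_1"
proof -
  have prod: "(\<Prod>i\<in>A. [:g i:]) = [:\<Prod>i\<in>A. g i:]" for A and g :: "'i \<Rightarrow> 'b"
    by (induction A rule: infinite_finite_induct) (auto simp: one_pCons)
  have pow: "[:y:] ^ j = [:y ^ j:]" for y :: 'b and j
    by (induction j) (auto simp: one_pCons)
  have sum: "(\<Sum>e\<in>A. [:g e:]) = [:\<Sum>e\<in>A. g e:]" for A and g :: "('i \<Rightarrow> nat) \<Rightarrow> 'b"
    by (induction A rule: infinite_finite_induct) auto
  show ?thesis
    by (simp add: hasse_def pow of_nat_poly prod sum mult_ac)
qed

text \<open>The unknowns are the coefficients, with one linear equation for each point of
  \<open>K\<close> and each Hasse derivative of order below \<open>m\<close>. The system is solved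
  over the field and transferred to constants of the polynomial ring, where vanishing is
  tested.\<close>

lemma exists_vanishing_polynomial:
  fixes K :: "('a::{field,finite} ^ 'n) set"
  assumes "card K * card {e :: 'n \<Rightarrow> nat. sum e UNIV < m} < card {e :: 'n \<Rightarrow> nat. sum e UNIV < d}"
  shows "\<exists>c :: ('n \<Rightarrow> nat) \<Rightarrow> 'a. (\<exists>e. sum e UNIV < d \<and> c e \<noteq> 0) \<and>
    (\<forall>a\<in>K. vanishes m (mpoly_eval {e. sum e UNIV < d} (\<lambda>e. [:c e:])) (\<lambda>i. [:a $ i:]))"
proof -
  let ?E = "\<lambda>d. {e :: 'n \<Rightarrow> nat. sum e UNIV < d}"
  have "\<exists>c. (\<exists>e\<in>?E d. c e \<noteq> 0) \<and> (\<forall>y\<in>K \<times> ?E m. (\<Sum>e\<in>?E d.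
      (\<Prod>i\<in>UNIV. of_nat (e i choose snd y i) * (fst y $ i) ^ (e i - snd y i)) * c e) = 0)"
    using assms
    by (intro homogeneous_system_solution)
       (auto simp: finite_bounded_exponents card_cartesian_product)
  then obtain c :: "('n \<Rightarrow> nat) \<Rightarrow> 'a" where "\<exists>e\<in>?E d. c e \<noteq> 0"
    and c: "\<And>y. y \<in> K \<times> ?E m \<Longrightarrow> (\<Sum>e\<in>?E d.
      (\<Prod>i\<in>UNIV. of_nat (e i choose snd y i) * (fst y $ i) ^ (e i - snd y i)) * c e) = 0"
    by blast
  moreover have "hasse (?E d) c (\<lambda>i. a $ i) k = 0" if "a \<in> K" "sum k UNIV < m" for a k
    using c[of "(a, k)"] that by (simp add: hasse_def mult.commute[of "c _"])
  then have "vanishes m (mpoly_eval (?E d) (\<lambda>e. [:c e:])) (\<lambda>i. [:a $ i:])" if "a \<in> K" for a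
    using that
    by (intro vanishes_if_hasse_zero) (simp_all add: finite_bounded_exponents hasse_const_poly)
  ultimately show ?thesis by blast
qed

lemma mpoly_eval_nonzero:
  fixes c :: "('i::finite \<Rightarrow> nat) \<Rightarrow> 'b::{idom,infinite}"
  assumes "finite E" "e \<in> E" "c e \<noteq> 0"
  shows "\<exists>x. mpoly_eval E c x \<noteq> 0"
proof -
  \<comment> \<open>Generalized for induction on the variables: the exponents in \<open>E\<close>
    need only be distinguished by their values on \<open>I\<close>, a property passed on to each
    class with fixed \<open>e i\<close>.\<close>
  have "\<forall>e\<in>E. c e = 0"
    if "finite I" "finite E" "\<And>e e'. e \<in> E \<Longrightarrow> e' \<in> E \<Longrightarrow> (\<And>i. i \<in> I \<Longrightarrow> e i = e' i) \<Longrightarrow> e = e'"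
      "\<And>x. (\<Sum>e\<in>E. c e * (\<Prod>i\<in>I. x i ^ e i)) = 0" for I E
    using that
  proof (induction I arbitrary: E rule: finite_induct)
    case empty
    show ?case
    proof
      fix e assume "e \<in> E"
      then have "E = {e}" using empty.prems(2) by blast
      then show "c e = 0" using empty.prems(3) by simp
    qed
  next
    case (insert i I)
    define N where "N = Max ((\<lambda>e. e i) ` E)"
    have N: "e i \<le> N" if "e \<in> E" for e
      using that insert.prems(1) by (simp add: N_def)
    define F where "F = (\<lambda>k. {e \<in> E. e i = k})"
    have "\<forall>e\<in>F k. c e = 0" if k: "k \<le> N" for k
    proof (rule insert.IH)
      show "finite (F k)" using insert.prems(1) by (simp add: F_def)
      show "e = e'" if "e \<in> F k" "e' \<in> F k" "\<And>i. i \<in> I \<Longrightarrow> e i = e' i" for e e'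
        using that by (intro insert.prems(2)) (auto simp: F_def)
      fix x
      define p where "p = (\<Sum>k\<le>N. monom (\<Sum>e\<in>F k. c e * (\<Prod>i\<in>I. x i ^ e i)) k)"
      have "poly p t = 0" for t
      proof -
        have "poly p t = (\<Sum>k\<le>N. \<Sum>e\<in>F k. c e * (t ^ e i * (\<Prod>i\<in>I. x i ^ e i)))"
          unfolding p_def poly_sum poly_monom sum_distrib_right
          by (intro sum.cong) (auto simp: F_def mult_ac)
        also have "\<dots> = (\<Sum>e\<in>E. c e * (t ^ e i * (\<Prod>i\<in>I. x i ^ e i)))"
          unfolding F_def using insert.prems(1) N by (intro sum.group) auto
        also have "\<dots> = (\<Sum>e\<in>E. c e * (\<Prod>j\<in>insert i I. (x(i := t)) j ^ e j))"
        proof -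
          have "(\<Prod>j\<in>I. (x(i := t)) j ^ e j) = (\<Prod>j\<in>I. x j ^ e j)" for e
            using insert.hyps by (intro prod.cong) auto
          then show ?thesis using insert.hyps by simp
        qed
        also have "\<dots> = 0" by (rule insert.prems(3))
        finally show ?thesis .
      qed
      then have "p = 0" by (intro poly_eqI_infinite) simp
      then have "coeff p k = 0" by simp
      then show "(\<Sum>e\<in>F k. c e * (\<Prod>i\<in>I. x i ^ e i)) = 0"
        using k by (simp add: p_def coeff_sum)
    qed
    then show ?case using N by (auto simp: F_def)
  qed
  from this[of UNIV E] assms show ?thesis
    unfolding mpoly_eval_def by fastforce
qed

section \<open>Linear images of a Kakeya set\<close>

definition GL :: "('a::{field,finite} ^ 'n \<Rightarrow> 'a ^ 'n) set" where
  "GL = {A. Vector_Spaces.linear (*s) (*s) A \<and> inj A}"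

lemma GL_comp: "A \<in> GL \<Longrightarrow> B \<in> GL \<Longrightarrow> A \<circ> B \<in> GL"
  unfolding GL_def using Vector_Spaces.linear_compose inj_compose by blast

lemma GL_image_Gr:
  assumes "A \<in> GL" "S \<in> Gr r"
  shows "A ` S \<in> Gr r"
proof -
  interpret A: Vector_Spaces.linear "(*s)" "(*s)" A using assms(1) by (simp add: GL_def)
  have "inj A" using assms(1) by (simp add: GL_def)
  then have "vec.dim (A ` S) = vec.dim S"
    by (intro vec.dim_image_eq A.linear_axioms) (meson inj_on_subset subset_UNIV)
  then show ?thesis using assms(2) by (simp add: Gr_def A.subspace_image)
qed

lemma GL_transitive:
  assumes "S \<in> Gr r" "T \<in> Gr r"
  shows "\<exists>A\<in>GL. A ` S = T"
proof -
  obtain B where B: "B \<subseteq> S" "vec.independent B" "S \<subseteq> vec.span B" "card B = vec.dim S"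
    using vec.basis_exists by blast
  obtain C where C: "C \<subseteq> T" "vec.independent C" "T \<subseteq> vec.span C" "card C = vec.dim T"
    using vec.basis_exists by blast
  have "card B = card C" using B C assms by (simp add: Gr_def)
  then obtain f where f: "bij_betw f B C"
    by (metis finite_same_card_bij finite)
  then obtain A where A: "Vector_Spaces.linear (*s) (*s) A" "inj A" "\<And>x. x \<in> B \<Longrightarrow> A x = f x"
    using vec.linear_independent_extend_inj[of B f] B(2) C(2) by (auto simp: bij_betw_def)
  interpret A: Vector_Spaces.linear "(*s)" "(*s)" A by fact
  have "S = vec.span B" "T = vec.span C"
    using B C assms vec.span_subspace unfolding Gr_def by (metis mem_Collect_eq)+
  moreover have "A ` B = C" using A(3) f by (auto simp: bij_betw_def image_iff)
  ultimately have "A ` S = T" using A.span_image by metis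
  then show ?thesis using A by (auto simp: GL_def)
qed

text \<open>The sets of maps carrying \<open>S\<close> to a given target partition
  \<open>GL\<close>, and they all have the same size: composing with a map from one target to
  another injects each into the other.\<close>

lemma card_GL_transporter:
  fixes S T :: "('a::{field,finite} ^ 'n) set"
  assumes S: "S \<in> Gr r" and T: "T \<in> Gr r"
  shows "card {A \<in> GL. A ` S = T} * card (Gr r :: ('a ^ 'n) set set)
    = card (GL :: ('a ^ 'n \<Rightarrow> 'a ^ 'n) set)"
proof -
  have le: "card {A \<in> GL. A ` S = T1} \<le> card {A \<in> GL. A ` S = T2}"
    if T12: "T1 \<in> Gr r" "T2 \<in> Gr r" for T1 T2 :: "('a ^ 'n) set"
  proof -
    obtain B where B: "B \<in> GL" "B ` T1 = T2" using GL_transitive[OF T12] by blast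
    have "inj B" using B(1) by (simp add: GL_def)
    have "inj_on ((\<circ>) B) {A \<in> GL. A ` S = T1}"
    proof (rule inj_onI)
      fix A A' assume "B \<circ> A = B \<circ> A'"
      then have "B (A x) = B (A' x)" for x by (metis comp_apply)
      then show "A = A'" using \<open>inj B\<close> by (simp add: fun_eq_iff inj_eq)
    qed
    moreover have "(\<circ>) B ` {A \<in> GL. A ` S = T1} \<subseteq> {A \<in> GL. A ` S = T2}"
    proof (rule image_subsetI)
      fix A assume "A \<in> {A \<in> GL. A ` S = T1}"
      then show "B \<circ> A \<in> {A \<in> GL. A ` S = T2}"
        using B GL_comp[OF B(1), of A] by (simp only: mem_Collect_eq image_comp[symmetric])
    qed
    ultimately show ?thesis by (rule card_inj_on_le) simp
  qed
  have "(GL :: ('a ^ 'n \<Rightarrow> 'a ^ 'n) set) = (\<Union>U\<in>Gr r. {A \<in> GL. A ` S = U})"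
    using GL_image_Gr[OF _ S] by auto
  then have "card (GL :: ('a ^ 'n \<Rightarrow> 'a ^ 'n) set) = card (\<Union>U\<in>Gr r. {A \<in> GL. A ` S = U})"
    by (rule arg_cong)
  also have "\<dots> = (\<Sum>U\<in>Gr r. card {A \<in> GL. A ` S = U})"
    by (rule card_UN_disjoint) auto
  also have "\<dots> = (\<Sum>U\<in>(Gr r :: ('a ^ 'n) set set). card {A \<in> GL. A ` S = T})"
    using le T by (intro sum.cong) (auto intro: antisym)
  finally show ?thesis by simp
qed

lemma card_GL_into:
  fixes S :: "('a::{field,finite} ^ 'n) set"
  assumes S: "S \<in> Gr r" and \<B>: "\<B> \<subseteq> Gr r"
  shows "card {A \<in> GL. A ` S \<in> \<B>} * card (Gr r :: ('a ^ 'n) set set)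
    = card \<B> * card (GL :: ('a ^ 'n \<Rightarrow> 'a ^ 'n) set)"
proof -
  have "{A \<in> GL. A ` S \<in> \<B>} = (\<Union>T\<in>\<B>. {A \<in> GL. A ` S = T})" by auto
  then have "card {A \<in> GL. A ` S \<in> \<B>} = (\<Sum>T\<in>\<B>. card {A \<in> GL. A ` S = T})"
    by (simp only:) (rule card_UN_disjoint, auto)
  then have "card {A \<in> GL. A ` S \<in> \<B>} * card (Gr r :: ('a ^ 'n) set set) =
      (\<Sum>T\<in>\<B>. card (GL :: ('a ^ 'n \<Rightarrow> 'a ^ 'n) set))"
    unfolding sum_distrib_right using card_GL_transporter[OF S] \<B>
    by (simp only: sum_distrib_right) (rule sum.cong, auto)
  then show ?thesis by simp
qed

lemma card_pairs_swap:
  assumes "finite X" "finite Y"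
  shows "(\<Sum>x\<in>X. card {y \<in> Y. P x y}) = (\<Sum>y\<in>Y. card {x \<in> X. P x y})"
proof -
  have "(\<Sum>x\<in>X. card {y \<in> Y. P x y}) = (\<Sum>x\<in>X. \<Sum>y\<in>Y. if P x y then 1 else 0)"
    using assms by (simp add: sum.If_cases Int_def)
  also have "\<dots> = (\<Sum>y\<in>Y. \<Sum>x\<in>X. if P x y then 1 else 0)" by (rule sum.swap)
  also have "\<dots> = (\<Sum>y\<in>Y. card {x \<in> X. P x y})"
    using assms by (simp add: sum.If_cases Int_def)
  finally show ?thesis .
qed

text \<open>Averaging over \<open>GL\<close>: a uniformly chosen \<open>A\<close> carries each
  \<open>S\<close> to a uniformly distributed subspace, so the mean overlap is
  \<open>card \<A> * card \<B>\<close> divided by the size of the Grassmannian, and some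
  \<open>A\<close> reaches the mean.\<close>

lemma exists_GL_overlap:
  fixes \<A> \<B> :: "('a::{field,finite} ^ 'n) set set"
  assumes "\<A> \<subseteq> Gr r" "\<B> \<subseteq> Gr r"
  shows "\<exists>A\<in>GL. card \<A> * card \<B> \<le>
    card {S \<in> \<A>. A ` S \<in> \<B>} * card (Gr r :: ('a ^ 'n) set set)"
proof (rule ccontr)
  let ?G = "GL :: ('a ^ 'n \<Rightarrow> 'a ^ 'n) set" and ?g = "card (Gr r :: ('a ^ 'n) set set)"
  assume "\<not> ?thesis"
  then have less: "card {S \<in> \<A>. A ` S \<in> \<B>} * ?g < card \<A> * card \<B>" if "A \<in> ?G" for A
    using that by (meson not_le)
  have "id \<in> ?G" by (simp add: GL_def vec.linear_id)
  then have "(\<Sum>A\<in>?G. card {S \<in> \<A>. A ` S \<in> \<B>} * ?g) < (\<Sum>A\<in>?G. card \<A> * card \<B>)"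
    using less by (intro sum_strict_mono) auto
  also have "\<dots> = (\<Sum>S\<in>\<A>. card {A \<in> ?G. A ` S \<in> \<B>} * ?g)"
  proof -
    have "(\<Sum>S\<in>\<A>. card {A \<in> ?G. A ` S \<in> \<B>} * ?g) = (\<Sum>S\<in>\<A>. card \<B> * card ?G)"
      using assms by (intro sum.cong refl card_GL_into) auto
    then show ?thesis by (simp only: sum_constant of_nat_id mult_ac)
  qed
  also have "\<dots> = (\<Sum>A\<in>?G. card {S \<in> \<A>. A ` S \<in> \<B>} * ?g)"
    unfolding sum_distrib_right[symmetric]
    by (subst card_pairs_swap[of \<A> ?G "\<lambda>S A. A ` S \<in> \<B>"]) simp_all
  finally show False by simp
qed

section \<open>Covering more directions by unions of linear images\<close>

definition directions :: "nat \<Rightarrow> ('a::{field,finite} ^ 'n) set \<Rightarrow> ('a ^ 'n) set set" where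
  "directions r K = {S \<in> Gr r. \<exists>x. (\<lambda>v. x + v) ` S \<subseteq> K}"

lemma directions_mono: "K \<subseteq> L \<Longrightarrow> directions r K \<subseteq> directions r L"
  unfolding directions_def by blast

lemma directions_GL_image:
  assumes "A \<in> GL" "S \<in> directions r K"
  shows "A ` S \<in> directions r (A ` K)"
proof -
  interpret A: Vector_Spaces.linear "(*s)" "(*s)" A using assms(1) by (simp add: GL_def)
  obtain x where x: "(\<lambda>v. x + v) ` S \<subseteq> K" "S \<in> Gr r"
    using assms(2) by (auto simp: directions_def)
  have "(\<lambda>v. A x + v) ` A ` S \<subseteq> A ` K"
    using x(1) by (auto simp: A.add[symmetric])
  then show ?thesis
    using GL_image_Gr[OF assms(1) x(2)] by (auto simp: directions_def)
qed

text \<open>Greedy choice: each new image of \<open>K\<close> is taken so that its directions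
  contain at least a fraction \<open>\<epsilon>\<close> of those still missed.\<close>

lemma amplify_directions:
  fixes K :: "('a::{field,finite} ^ 'n) set" and \<epsilon> :: real
  assumes "\<epsilon> * card (Gr r :: ('a ^ 'n) set set) \<le> card (directions r K)" "\<epsilon> \<le> 1"
  shows "\<exists>L :: ('a ^ 'n) set. card L \<le> t * card K \<and>
    card (Gr r - directions r L) \<le> (1 - \<epsilon>) ^ t * card (Gr r :: ('a ^ 'n) set set)"
proof (induction t)
  case 0
  have "card (Gr r - directions r ({} :: ('a ^ 'n) set)) \<le> card (Gr r :: ('a ^ 'n) set set)"
    by (rule card_mono) auto
  then show ?case by (intro exI[of _ "{}"]) simp
next
  case (Suc t)
  let ?g = "card (Gr r :: ('a ^ 'n) set set)"
  obtain L :: "('a ^ 'n) set" where L: "card L \<le> t * card K" "card (Gr r - directions r L) \<le> (1 - \<epsilon>) ^ t * ?g"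
    using Suc by blast
  define B where "B = Gr r - directions r L"
  obtain A where A: "A \<in> GL" "card (directions r K) * card B \<le>
      card {S \<in> directions r K. A ` S \<in> B} * ?g"
    using exists_GL_overlap[of "directions r K" r B] by (auto simp: B_def directions_def)
  define D where "D = (`) A ` {S \<in> directions r K. A ` S \<in> B}"
  have "inj A" using A(1) by (simp add: GL_def)
  then have card_D: "card D = card {S \<in> directions r K. A ` S \<in> B}"
    unfolding D_def by (intro card_image) (simp add: inj_on_def inj_image_eq_iff)
  have "D \<subseteq> B" by (auto simp: D_def)
  have "Gr r - directions r (L \<union> A ` K) \<subseteq> B - D"
  proof
    fix S assume S: "S \<in> Gr r - directions r (L \<union> A ` K)"
    then have "S \<in> B" using directions_mono[of L "L \<union> A ` K" r] by (auto simp: B_def)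
    moreover have "S \<notin> directions r (A ` K)"
      using S directions_mono[of "A ` K" "L \<union> A ` K" r] by auto
    then have "S \<notin> D" using directions_GL_image[OF A(1), of _ r K] unfolding D_def by blast
    ultimately show "S \<in> B - D" by simp
  qed
  then have "card (Gr r - directions r (L \<union> A ` K)) \<le> card (B - D)" by (intro card_mono) auto
  also have "\<dots> = card B - card D" using \<open>D \<subseteq> B\<close> by (simp add: card_Diff_subset)
  finally have 1: "real (card (Gr r - directions r (L \<union> A ` K))) \<le> real (card B) - card D"
    using card_mono[OF _ \<open>D \<subseteq> B\<close>] by (simp add: of_nat_diff)
  have "\<epsilon> * card B \<le> card D"
  proof (cases "?g = 0")
    case True
    then show ?thesis by (simp add: B_def)
  next
    case False
    have "real (card (directions r K) * card B) \<le> real (card D * ?g)"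
      using A(2) unfolding card_D by (rule of_nat_mono)
    then have "real (card (directions r K)) * card B \<le> card D * real ?g" by simp
    moreover have "(\<epsilon> * ?g) * card B \<le> real (card (directions r K)) * card B"
      using assms(1) by (rule mult_right_mono) simp
    ultimately have "(\<epsilon> * card B) * ?g \<le> card D * real ?g" by (simp add: mult_ac)
    then show ?thesis using False by simp
  qed
  with 1 have "card (Gr r - directions r (L \<union> A ` K)) \<le> (1 - \<epsilon>) * card B"
    by (simp add: algebra_simps)
  also have "\<dots> \<le> (1 - \<epsilon>) * ((1 - \<epsilon>) ^ t * ?g)"
    using L(2) assms(2) unfolding B_def by (intro mult_left_mono) auto
  finally have "card (Gr r - directions r (L \<union> A ` K)) \<le> (1 - \<epsilon>) ^ Suc t * ?g" by simp
  moreover have "card (L \<union> A ` K) \<le> Suc t * card K"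
    using card_Un_le[of L "A ` K"] card_image_le[of K A] L(1) by simp
  ultimately show ?case by blast
qed

text \<open>A basis of the span of \<open>V\<close> is enlarged to \<open>r\<close> independent
  vectors inside a basis of the whole space. With \<open>V = {}\<close> this also shows that
  \<open>Gr r\<close> is nonempty.\<close>

lemma subset_of_Gr:
  fixes V :: "('a::{field,finite} ^ 'n) set"
  assumes "card V \<le> r" "r \<le> CARD('n)"
  shows "\<exists>S\<in>Gr r. V \<subseteq> S"
proof -
  obtain B where B: "B \<subseteq> V" "vec.independent B" "V \<subseteq> vec.span B" "card B = vec.dim V"
    by (rule vec.basis_exists)
  obtain C where C: "B \<subseteq> C" "C \<subseteq> UNIV" "vec.independent C" "UNIV \<subseteq> vec.span C"
    by (rule vec.maximal_independent_subset_extend[OF subset_UNIV B(2)])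
  have "card C = CARD('n)"
    using vec.dim_eq_card[of C UNIV] C(3,4) by (simp add: top.extremum_unique card_cart_basis)
  moreover have "card B \<le> r" using card_mono[OF _ B(1)] assms(1) by simp
  ultimately obtain D where D: "B \<subseteq> D" "D \<subseteq> C" "card D = r"
    using exists_subset_between[of B r C] C(1) assms(2) by (metis finite)
  have "vec.independent D" using vec.independent_mono[OF C(3) D(2)] .
  then have "vec.span D \<in> Gr r" using D(3) by (simp add: Gr_def vec.dim_eq_card_independent)
  moreover have "V \<subseteq> vec.span D" using B(3) vec.span_mono[OF D(1)] by (rule order_trans)
  ultimately show ?thesis by blast
qed

text \<open>Every tuple lies in some \<open>r\<close>-dimensional subspace, and \<open>GL\<close> moves this subspace into \<open>\<A>\<close>
  with probability \<open>|\<A>| / |Gr|\<close>.\<close>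

lemma card_tuples_in_subspaces:
  fixes \<A> :: "('a::{field,finite} ^ 'n) set set"
  assumes "\<A> \<subseteq> Gr r" "r \<le> CARD('n)"
  shows "card \<A> * card (PiE {..<r} (\<lambda>_. UNIV :: ('a ^ 'n) set))
    \<le> card (Gr r :: ('a ^ 'n) set set) *
       card {\<tau> \<in> PiE {..<r} (\<lambda>_. UNIV). \<exists>S\<in>\<A>. \<tau> ` {..<r} \<subseteq> S}"
proof -
  let ?G = "GL :: ('a ^ 'n \<Rightarrow> 'a ^ 'n) set" and ?g = "card (Gr r :: ('a ^ 'n) set set)"
  let ?T = "PiE {..<r} (\<lambda>_. UNIV :: ('a ^ 'n) set)"
  let ?good = "{\<tau> \<in> ?T. \<exists>S\<in>\<A>. \<tau> ` {..<r} \<subseteq> S}"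
  have [simp]: "finite ?T" by (simp add: finite_PiE)
  have 1: "card \<A> * card ?G \<le> card {A \<in> ?G. \<exists>S\<in>\<A>. A ` \<tau> ` {..<r} \<subseteq> S} * ?g" for \<tau> :: "nat \<Rightarrow> 'a ^ 'n"
  proof -
    have "card (\<tau> ` {..<r}) \<le> r" using card_image_le[of "{..<r}" \<tau>] by simp
    then obtain S where S: "S \<in> Gr r" "\<tau> ` {..<r} \<subseteq> S"
      using subset_of_Gr[of "\<tau> ` {..<r}" r] assms(2) by auto
    have "card \<A> * card ?G = card {A \<in> ?G. A ` S \<in> \<A>} * ?g"
      using card_GL_into[OF S(1) assms(1)] by simp
    also have "\<dots> \<le> card {A \<in> ?G. \<exists>S\<in>\<A>. A ` \<tau> ` {..<r} \<subseteq> S} * ?g"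
    proof (intro mult_le_mono1 card_mono subsetI)
      fix A assume A: "A \<in> {A \<in> ?G. A ` S \<in> \<A>}"
      moreover have "A ` \<tau> ` {..<r} \<subseteq> A ` S" using S(2) by (rule image_mono)
      ultimately show "A \<in> {A \<in> ?G. \<exists>S\<in>\<A>. A ` \<tau> ` {..<r} \<subseteq> S}" by blast
    qed simp
    finally show ?thesis .
  qed
  \<comment> \<open>An injective \<open>A\<close> acts injectively on tuples, so the number of
    tuples it carries into a member of \<open>\<A>\<close> is bounded independently of
    \<open>A\<close>.\<close>
  have 2: "card {\<tau> \<in> ?T. \<exists>S\<in>\<A>. A ` \<tau> ` {..<r} \<subseteq> S} \<le> card ?good" if "A \<in> ?G" for A
  proof (rule card_inj_on_le)
    have "inj A" using that by (simp add: GL_def)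
    show "inj_on (\<lambda>\<tau>. \<lambda>k\<in>{..<r}. A (\<tau> k)) {\<tau> \<in> ?T. \<exists>S\<in>\<A>. A ` \<tau> ` {..<r} \<subseteq> S}"
    proof (rule inj_onI)
      fix \<tau> \<upsilon> assume *: "\<tau> \<in> {\<tau> \<in> ?T. \<exists>S\<in>\<A>. A ` \<tau> ` {..<r} \<subseteq> S}" "\<upsilon> \<in> {\<tau> \<in> ?T. \<exists>S\<in>\<A>. A ` \<tau> ` {..<r} \<subseteq> S}"
        "(\<lambda>k\<in>{..<r}. A (\<tau> k)) = (\<lambda>k\<in>{..<r}. A (\<upsilon> k))"
      have "\<tau> k = \<upsilon> k" if "k \<in> {..<r}" for k
        using fun_cong[OF *(3), of k] that \<open>inj A\<close> by (simp add: inj_eq)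
      moreover have "\<tau> \<in> ?T" "\<upsilon> \<in> ?T" using *(1,2) by simp_all
      ultimately show "\<tau> = \<upsilon>" by (intro PiE_ext)
    qed
    show "(\<lambda>\<tau>. \<lambda>k\<in>{..<r}. A (\<tau> k)) ` {\<tau> \<in> ?T. \<exists>S\<in>\<A>. A ` \<tau> ` {..<r} \<subseteq> S} \<subseteq> ?good"
      by (auto simp: image_image)
  qed simp
  have "card ?T * (card \<A> * card ?G) = (\<Sum>\<tau>\<in>?T. card \<A> * card ?G)" by simp
  also have "\<dots> \<le> (\<Sum>\<tau>\<in>?T. card {A \<in> ?G. \<exists>S\<in>\<A>. A ` \<tau> ` {..<r} \<subseteq> S} * ?g)"
    by (intro sum_mono 1)
  also have "\<dots> = (\<Sum>A\<in>?G. card {\<tau> \<in> ?T. \<exists>S\<in>\<A>. A ` \<tau> ` {..<r} \<subseteq> S} * ?g)"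
    unfolding sum_distrib_right[symmetric] by (subst card_pairs_swap[of ?T ?G "\<lambda>\<tau> A. \<exists>S\<in>\<A>. A ` \<tau> ` {..<r} \<subseteq> S"]) simp_all
  also have "\<dots> \<le> (\<Sum>A\<in>?G. card ?good * ?g)"
    by (intro sum_mono mult_le_mono1 2)
  also have "\<dots> = card ?G * (card ?good * ?g)" by simp
  finally have "card ?G * (card \<A> * card ?T) \<le> card ?G * (?g * card ?good)"
    by (simp only: mult_ac)
  moreover have "id \<in> ?G" by (simp add: GL_def vec.linear_id)
  then have "card ?G > 0" by (auto simp: card_gt_0_iff)
  ultimately show ?thesis by simp
qed

section \<open>The polynomial method\<close>

lemma vanishes_zero:
  assumes "polyfun I d f"
  shows "vanishes 0 f a"
  using polyfun_line[OF assms] by (simp add: vanishes_def)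

text \<open>The condition on coefficients, unlike \<open>degree p < r\<close>, admits the zero
  polynomial for \<open>r = 0\<close> too.\<close>

lemma card_bounded_degree_polys:
  "card {p :: 'a::{comm_ring_1,finite} poly. \<forall>k\<ge>r. coeff p k = 0} = CARD('a) ^ r"
  "finite {p :: 'a poly. \<forall>k\<ge>r. coeff p k = 0}"
proof -
  have "bij_betw (\<lambda>p. \<lambda>k\<in>{..<r}. coeff p k) {p :: 'a poly. \<forall>k\<ge>r. coeff p k = 0}
      (PiE {..<r} (\<lambda>_. UNIV))"
  proof (rule bij_betwI[where g = "\<lambda>f. \<Sum>k<r. monom (f k) k"])
    show "(\<Sum>k<r. monom ((\<lambda>k\<in>{..<r}. coeff p k) k) k) = p"
      if "p \<in> {p :: 'a poly. \<forall>k\<ge>r. coeff p k = 0}" for p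
      using that by (auto simp: poly_eq_iff coeff_sum)
    show "(\<lambda>k\<in>{..<r}. coeff (\<Sum>k<r. monom (f k) k) k) = f"
      if "f \<in> PiE {..<r} (\<lambda>_. UNIV :: 'a set)" for f
      using that by (auto simp: fun_eq_iff coeff_sum PiE_def extensional_def)
  qed (auto simp: coeff_sum)
  then show "card {p :: 'a poly. \<forall>k\<ge>r. coeff p k = 0} = CARD('a) ^ r"
    "finite {p :: 'a poly. \<forall>k\<ge>r. coeff p k = 0}"
    using bij_betw_same_card bij_betw_finite by (fastforce simp: card_PiE finite_PiE)+
qed

text \<open>A generating polynomial \<open>\<Sum>k. \<tau>\<^sub>k y\<^sup>k\<close> with all \<open>\<tau>\<^sub>k\<close> in \<open>S\<close> lies in the span of \<open>S\<close> over the
  polynomial ring, and so the leading form inherits the vanishing along \<open>x + S\<close>.\<close>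

lemma leading_form_vanishes_at_tuple:
  fixes c :: "('n::finite \<Rightarrow> nat) \<Rightarrow> 'a::{field,finite}" and K :: "('a ^ 'n) set"
  assumes S: "S \<in> directions r K" and \<tau>: "\<tau> ` {..<r} \<subseteq> S"
    and "finite E" and deg: "\<And>e. e \<in> E \<Longrightarrow> sum e UNIV \<le> d"
    and van: "\<And>a. a \<in> K \<Longrightarrow> vanishes m (mpoly_eval E (\<lambda>e. [:c e:])) (\<lambda>i. [:a $ i:])"
    and le: "d + (CARD('a) - 1) * l \<le> CARD('a) * m"
  shows "vanishes l (mpoly_eval {e \<in> E. sum e UNIV = d} (\<lambda>e. [:c e:]))
    (\<lambda>i. \<Sum>k<r. monom (\<tau> k $ i) k)"
proof -
  obtain x where Gr: "S \<in> Gr r" and x: "\<And>v. v \<in> S \<Longrightarrow> x + v \<in> K"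
    using S by (auto simp: directions_def)
  have subS: "vec.subspace S" using Gr by (simp add: Gr_def)
  obtain B where B: "B \<subseteq> S" "vec.independent B" "S \<subseteq> vec.span B" "card B = vec.dim S"
    by (rule vec.basis_exists)
  have "\<exists>\<alpha>. \<tau> k = (\<Sum>b\<in>B. \<alpha> b *s b)" if "k < r" for k
  proof -
    have "\<tau> k \<in> vec.span B" using that \<tau> B(3) by auto
    then show ?thesis by (auto simp: vec.span_finite)
  qed
  then obtain \<alpha> where \<alpha>: "\<And>k. k < r \<Longrightarrow> \<tau> k = (\<Sum>b\<in>B. \<alpha> k b *s b)" by metis
  \<comment> \<open>The coordinates, in the basis \<open>B\<close>, of the generating polynomial of
    the tuple; they are polynomials rather than field elements.\<close>
  define u where "u = (\<lambda>b. \<Sum>k<r. monom (\<alpha> k b) k)"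
  have u: "(\<Sum>k<r. monom (\<tau> k $ i) k) = (\<Sum>b\<in>B. u b * [:b $ i:])" for i
  proof -
    have "(\<Sum>k<r. monom (\<tau> k $ i) k) = (\<Sum>k<r. \<Sum>b\<in>B. monom (\<alpha> k b) k * [:b $ i:])"
      by (intro sum.cong refl) (simp add: \<alpha> monom_sum smult_monom mult.commute)
    also have "\<dots> = (\<Sum>b\<in>B. \<Sum>k<r. monom (\<alpha> k b) k * [:b $ i:])" by (rule sum.swap)
    also have "\<dots> = (\<Sum>b\<in>B. u b * [:b $ i:])"
      unfolding u_def by (simp only: sum_distrib_right)
    finally show ?thesis .
  qed
  \<comment> \<open>The constants form a copy of the field inside the polynomial ring; with
    parameters in \<open>C\<close> the flat stays inside \<open>K\<close>.\<close>
  define C where "C = range (\<lambda>a :: 'a. [:a:])"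
  have card_C: "card C = CARD('a)"
    unfolding C_def by (intro card_image) (auto simp: inj_on_def)
  have "card {0, 1 :: 'a} \<le> CARD('a)" by (intro card_mono) auto
  then have "card C \<ge> 2" by (simp add: card_C)
  have flat: "vanishes m (mpoly_eval E (\<lambda>e. [:c e:])) (\<lambda>i. [:x $ i:] + (\<Sum>b\<in>B. w b * [:b $ i:]))"
    if w: "w \<in> PiE B (\<lambda>_. C)" for w
  proof -
    have "\<forall>b\<in>B. \<exists>a. w b = [:a:]" using w by (auto simp: C_def PiE_def Pi_def)
    then obtain a where a: "\<And>b. b \<in> B \<Longrightarrow> w b = [:a b:]" by metis
    have "(\<Sum>b\<in>B. a b *s b) \<in> S"
      using B(1) by (intro vec.subspace_sum[OF subS] vec.subspace_scale[OF subS]) auto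
    note van[OF x[OF this]]
    moreover have "[:(x + (\<Sum>b\<in>B. a b *s b)) $ i:] = [:x $ i:] + (\<Sum>b\<in>B. w b * [:b $ i:])" for i
    proof -
      have "(\<Sum>b\<in>B. w b * [:b $ i:]) = (\<Sum>b\<in>B. [:a b * b $ i:])"
        by (intro sum.cong refl) (simp add: a mult.commute)
      also have "\<dots> = [:\<Sum>b\<in>B. a b * b $ i:]"
        by (induction B rule: infinite_finite_induct) auto
      finally show ?thesis by simp
    qed
    ultimately show ?thesis by simp
  qed
  show ?thesis
  proof (rule vanishes_leading_form[where x = "\<lambda>i. [:x $ i:]"])
    fix y :: "'a poly"
    \<comment> \<open>The parameters \<open>y * u b\<close> need not lie in the grid
      \<open>C\<close>: vanishing along the whole flat is what reaches them.\<close>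
    have "vanishes l (mpoly_eval E (\<lambda>e. [:c e:])) (\<lambda>i. [:x $ i:] + (\<Sum>b\<in>B. (y * u b) * [:b $ i:]))"
    proof (rule vanishes_on_flat[OF _ _ _ \<open>card C \<ge> 2\<close> flat])
      show "polyfun UNIV d (mpoly_eval E (\<lambda>e. [:c e:]))" by (rule polyfun_mpoly_eval[OF deg])
      show "finite C" by (simp add: C_def)
      show "d + (card C - 1) * l \<le> card C * m" using le by (simp only: card_C)
    qed simp_all
    then show "vanishes l (mpoly_eval E (\<lambda>e. [:c e:]))
        (\<lambda>i. [:x $ i:] + y * (\<Sum>k<r. monom (\<tau> k $ i) k))"
      by (simp only: u sum_distrib_left mult.assoc)
  qed (use \<open>finite E\<close> deg in auto)
qed

text \<open>A suitable polynomial vanishing on \<open>K\<close> to order \<open>m\<close> would have a leading form vanishing at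
  too many points of the grid of vectors of polynomials of degree less than \<open>r\<close>.\<close>

lemma card_exponents_le:
  fixes K :: "('a::{field,finite} ^ 'n) set"
  assumes "r \<le> CARD('n)"
    and m: "d + (CARD('a) - 1) * l \<le> CARD('a) * m"
    and l: "d * card (Gr r :: ('a ^ 'n) set set) \<le> CARD('a) ^ r * l * card (directions r K)"
  shows "card {e :: 'n \<Rightarrow> nat. sum e UNIV < d} \<le> card K * card {e :: 'n \<Rightarrow> nat. sum e UNIV < m}"
proof (rule ccontr)
  let ?q = "CARD('a)" and ?g = "card (Gr r :: ('a ^ 'n) set set)"
  let ?E = "{e :: 'n \<Rightarrow> nat. sum e UNIV < d}" and ?\<A> = "directions r K"
  assume "\<not> ?thesis"
  then have "card K * card {e :: 'n \<Rightarrow> nat. sum e UNIV < m} < card ?E" by simp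
  from exists_vanishing_polynomial[OF this] obtain c :: "('n \<Rightarrow> nat) \<Rightarrow> 'a" and e0
    where e0: "sum e0 UNIV < d" "c e0 \<noteq> 0"
    and van: "\<And>a. a \<in> K \<Longrightarrow> vanishes m (mpoly_eval ?E (\<lambda>e. [:c e:])) (\<lambda>i. [:a $ i:])"
    by blast
  define F where "F = {e \<in> ?E. c e \<noteq> 0}"
  have "finite F" unfolding F_def by (simp add: finite_bounded_exponents)
  have F_eval: "mpoly_eval ?E (\<lambda>e. [:c e:]) = mpoly_eval F (\<lambda>e. [:c e:])"
    unfolding mpoly_eval_def F_def
    by (intro ext sum.mono_neutral_right finite_bounded_exponents) auto
  \<comment> \<open>The leading form is taken in the actual degree \<open>d'\<close>; the strict
    inequality \<open>d' < d\<close> is what the final count contradicts.\<close>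
  define d' where "d' = Max ((\<lambda>e. sum e UNIV) ` F)"
  have "F \<noteq> {}" using e0 by (auto simp: F_def)
  have deg: "sum e UNIV \<le> d'" if "e \<in> F" for e
    using that \<open>finite F\<close> by (simp add: d'_def)
  obtain e1 where e1: "e1 \<in> F" "sum e1 UNIV = d'"
  proof -
    have "d' \<in> (\<lambda>e. sum e UNIV) ` F"
      unfolding d'_def using \<open>finite F\<close> \<open>F \<noteq> {}\<close> by (intro Max_in) auto
    then show thesis using that by blast
  qed
  then have "d' < d" by (auto simp: F_def)
  define h :: "('n \<Rightarrow> 'a poly) \<Rightarrow> 'a poly" where "h = mpoly_eval {e \<in> F. sum e UNIV = d'} (\<lambda>e. [:c e:])"
  have h: "polyfun UNIV d' h" unfolding h_def by (rule polyfun_mpoly_eval) auto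
  have "c e1 \<noteq> 0" using e1(1) by (simp add: F_def)
  then have "\<exists>x. h x \<noteq> 0"
    unfolding h_def using e1 \<open>finite F\<close> by (intro mpoly_eval_nonzero[where e = e1]) simp_all
  then obtain x where x: "h x \<noteq> 0" ..
  let ?T = "PiE {..<r} (\<lambda>_. UNIV :: ('a ^ 'n) set)"
  define good where "good = {\<tau> \<in> ?T. \<exists>S\<in>?\<A>. \<tau> ` {..<r} \<subseteq> S}"
  define \<beta> where "\<beta> = (\<lambda>\<tau> :: nat \<Rightarrow> 'a ^ 'n. \<lambda>i. \<Sum>k<r. monom (\<tau> k $ i) k)"
  define P where "P = {p :: 'a poly. \<forall>k\<ge>r. coeff p k = 0}"
  have P: "card P = ?q ^ r" "finite P" unfolding P_def by (rule card_bounded_degree_polys)+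
  have "finite ?T" by (simp add: finite_PiE)
  then have "finite good" by (simp add: good_def)
  have "inj_on \<beta> good"
  proof (rule inj_onI)
    fix \<tau> \<upsilon> assume *: "\<tau> \<in> good" "\<upsilon> \<in> good" "\<beta> \<tau> = \<beta> \<upsilon>"
    have "\<tau> k = \<upsilon> k" if "k \<in> {..<r}" for k
    proof -
      have "coeff (\<beta> \<tau> i) k = \<tau> k $ i" for \<tau> i
        using that by (simp add: \<beta>_def coeff_sum)
      then show ?thesis using *(3) by (metis vec_eq_iff)
    qed
    moreover have "\<tau> \<in> ?T" "\<upsilon> \<in> ?T" using *(1,2) by (simp_all add: good_def)
    ultimately show "\<tau> = \<upsilon>" by (intro PiE_ext)
  qed
  have grid: "\<beta> ` good \<subseteq> PiE UNIV (\<lambda>_. P)"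
    by (auto simp: \<beta>_def P_def coeff_sum)
  \<comment> \<open>Only grid points coming from good tuples are known to have order
    \<open>l\<close>; order 0 is claimed at the others.\<close>
  define \<mu> where "\<mu> = (\<lambda>v. if v \<in> \<beta> ` good then l else 0)"
  have "vanishes (\<mu> v) h v" for v
  proof (cases "v \<in> \<beta> ` good")
    case True
    then obtain \<tau> S where \<tau>: "S \<in> ?\<A>" "\<tau> ` {..<r} \<subseteq> S" "v = \<beta> \<tau>" by (auto simp: good_def)
    have "vanishes l h (\<beta> \<tau>)"
      unfolding h_def \<beta>_def
    proof (rule leading_form_vanishes_at_tuple[OF \<tau>(1,2) \<open>finite F\<close> deg])
      show "vanishes m (mpoly_eval F (\<lambda>e. [:c e:])) (\<lambda>i. [:a $ i:])" if "a \<in> K" for a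
        using van[OF that] unfolding F_eval .
      show "d' + (?q - 1) * l \<le> ?q * m" using m \<open>d' < d\<close> by simp
    qed
    then show ?thesis using True \<tau>(3) by (simp add: \<mu>_def)
  next
    case False
    then show ?thesis using vanishes_zero[OF h] by (simp add: \<mu>_def)
  qed
  then have "card P * (\<Sum>v\<in>PiE UNIV (\<lambda>_. P). \<mu> v) \<le> d' * card P ^ CARD('n)"
    by (intro schwartz_zippel_multiplicity[where f = h and x = x] P(2) h x) simp_all
  moreover have "(\<Sum>v\<in>PiE UNIV (\<lambda>_. P). \<mu> v) = card good * l"
  proof -
    have "(\<Sum>v\<in>PiE UNIV (\<lambda>_. P). \<mu> v) = (\<Sum>v\<in>\<beta> ` good. l)"
      using grid P(2)
      by (intro sum.mono_neutral_cong_right) (simp_all add: \<mu>_def finite_PiE)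
    then show ?thesis using \<open>inj_on \<beta> good\<close> by (simp add: card_image)
  qed
  ultimately have sz: "?q ^ r * (card good * l) \<le> d' * (?q ^ r) ^ CARD('n)" by (simp add: P(1))
  have "card ?T = (?q ^ r) ^ CARD('n)"
    by (simp add: card_PiE power_mult[symmetric] mult.commute)
  then have tuples: "card ?\<A> * (?q ^ r) ^ CARD('n) \<le> ?g * card good"
    using card_tuples_in_subspaces[of ?\<A> r] assms(1) by (auto simp: good_def directions_def)
  let ?N = "(?q ^ r) ^ CARD('n)"
  have "Gr r \<noteq> ({} :: ('a ^ 'n) set set)"
    using subset_of_Gr[of "{}" r] assms(1) by (metis card.empty empty_iff zero_le)
  then have "?g > 0" by (simp add: card_gt_0_iff)
  \<comment> \<open>The choice of \<open>l\<close>, the count of good tuples and Schwartz-Zippel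
    combine to replace \<open>d\<close> by the smaller \<open>d'\<close>.\<close>
  have "?N * (d * ?g) \<le> ?N * (?q ^ r * l * card ?\<A>)" using l by (rule mult_le_mono2)
  also have "\<dots> = ?q ^ r * l * (card ?\<A> * ?N)" by (simp only: mult_ac)
  also have "\<dots> \<le> ?q ^ r * l * (?g * card good)" using tuples by (rule mult_le_mono2)
  also have "\<dots> = ?g * (?q ^ r * (card good * l))" by (simp only: mult_ac)
  also have "\<dots> \<le> ?g * (d' * ?N)" using sz by (rule mult_le_mono2)
  also have "\<dots> = ?N * (d' * ?g)" by (simp only: mult_ac)
  also have "\<dots> < ?N * (d * ?g)" using \<open>d' < d\<close> \<open>?g > 0\<close> by simp
  finally show False by simp
qed

section \<open>The Kakeya bounds\<close>

text \<open>Stars and bars: the slack \<open>d - 1 - sum e UNIV\<close> is prepended, giving lists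
  of length \<open>?n + 1\<close> with sum \<open>d - 1\<close>.\<close>

lemma card_bounded_exponents:
  assumes "d > 0"
  shows "card {e :: 'n::finite \<Rightarrow> nat. sum e UNIV < d} = (d + CARD('n) - 1) choose CARD('n)"
proof -
  let ?n = "CARD('n)"
  obtain h where h: "bij_betw h {..<?n} (UNIV :: 'n set)"
    using ex_bij_betw_nat_finite[of "UNIV :: 'n set"] by (auto simp: atLeast0LessThan)
  define g where "g = inv_into {..<?n} h"
  have g: "g i < ?n" "h (g i) = i" for i
    using bij_betw_imp_surj_on[OF h] inv_into_into[of i h "{..<?n}"] f_inv_into_f[of i h "{..<?n}"]
    by (auto simp: g_def)
  have gh: "g (h k) = k" if "k < ?n" for k
    using h that by (simp add: g_def bij_betw_def)
  have sum: "(\<Sum>k<?n. e (h k)) = sum e UNIV" for e :: "'n \<Rightarrow> nat"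
    by (rule sum.reindex_bij_betw[OF h])
  have "bij_betw (\<lambda>e. (d - 1 - sum e UNIV) # map (\<lambda>k. e (h k)) [0..<?n])
      {e. sum e UNIV < d} {l. length l = ?n + 1 \<and> sum_list l = d - 1}"
  proof (rule bij_betwI[where g = "\<lambda>l i. tl l ! g i"])
    show "(\<lambda>e. (d - 1 - sum e UNIV) # map (\<lambda>k. e (h k)) [0..<?n]) \<in>
        {e. sum e UNIV < d} \<rightarrow> {l. length l = ?n + 1 \<and> sum_list l = d - 1}"
      using assms by (auto simp: interv_sum_list_conv_sum_set_nat atLeast0LessThan sum)
    have tl: "sum (\<lambda>i. tl l ! g i) UNIV = sum_list (tl l)" if "length l = ?n + 1" for l :: "nat list"
    proof -
      have "(\<Sum>k<?n. tl l ! g (h k)) = (\<Sum>k<?n. tl l ! k)" by (intro sum.cong) (auto simp: gh)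
      then show ?thesis
        using that sum[of "\<lambda>i. tl l ! g i"] by (simp add: sum_list_sum_nth atLeast0LessThan)
    qed
    show "(\<lambda>l i. tl l ! g i) \<in>
        {l. length l = ?n + 1 \<and> sum_list l = d - 1} \<rightarrow> {e. sum e UNIV < d}"
    proof
      fix l assume l: "l \<in> {l. length l = ?n + 1 \<and> sum_list l = d - 1}"
      then obtain a l' where "l = a # l'" by (cases l) auto
      then show "(\<lambda>i. tl l ! g i) \<in> {e. sum e UNIV < d}"
        using l tl[of l] assms by auto
    qed
    show "(\<lambda>i. tl ((d - 1 - sum e UNIV) # map (\<lambda>k. e (h k)) [0..<?n]) ! g i) = e" for e
      using g by auto
    show "(d - 1 - (\<Sum>i\<in>UNIV. tl l ! g i)) # map (\<lambda>k. tl l ! g (h k)) [0..<?n] = l"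
      if l_in: "l \<in> {l. length l = ?n + 1 \<and> sum_list l = d - 1}" for l
    proof -
      obtain a l' where l: "l = a # l'" using l_in by (cases l) auto
      have "map (\<lambda>k. l' ! g (h k)) [0..<?n] = l'"
        using l_in l by (intro nth_equalityI) (auto simp: gh)
      moreover have "a + sum_list l' = d - 1" using l_in l by simp
      ultimately show ?thesis using tl[of l] l_in l by simp
    qed
  qed
  then have "card {e :: 'n \<Rightarrow> nat. sum e UNIV < d} = (d - 1 + (?n + 1) - 1) choose (d - 1)"
    by (simp only: bij_betw_same_card card_length_sum_list)
  also have "d - 1 + (?n + 1) - 1 = (d - 1) + ?n" by simp
  also have "((d - 1) + ?n) choose (d - 1) = ((d - 1) + ?n) choose ?n"
    by (subst binomial_symmetric) auto
  also have "(d - 1) + ?n = d + ?n - 1" using assms by simp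
  finally show ?thesis .
qed

text \<open>The right-hand side is the rising product from \<open>d\<close> to
  \<open>d + n - 1\<close>, whose factors are all at least \<open>d\<close>.\<close>

lemma power_le_fact_times_binomial: "d > 0 \<Longrightarrow> d ^ n \<le> fact n * ((d + n - 1) choose n)"
proof (induction n)
  case (Suc n)
  have "d ^ Suc n \<le> d * (fact n * ((d + n - 1) choose n))" using Suc by simp
  also have "\<dots> \<le> (d + n) * (fact n * ((d + n - 1) choose n))" by (intro mult_le_mono1) simp
  also have "\<dots> = fact n * (Suc (d + n - 1) * ((d + n - 1) choose n))"
    using Suc.prems by simp
  also have "\<dots> = fact (Suc n) * ((d + Suc n - 1) choose Suc n)"
    using Suc.prems by (subst Suc_times_binomial_eq) (simp add: algebra_simps)
  finally show ?case .
qed simp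

text \<open>\<open>D / M\<close> is \<open>q / (1 + (q - 1) / (\<delta> * q ^ r))\<close> for the
  exact density \<open>\<delta>\<close> of the covered directions, with denominators cleared. The
  bound arises by letting the multiplicities tend to infinity.\<close>

theorem partial_Kakeya_bound_nat:
  fixes K :: "('a::{field,finite} ^ 'n) set"
  assumes "r \<le> CARD('n)" "directions r K \<noteq> {}"
  defines "D \<equiv> CARD('a) ^ (r + 1) * card (directions r K)"
    and "M \<equiv> CARD('a) ^ r * card (directions r K) +
      (CARD('a) - 1) * card (Gr r :: ('a ^ 'n) set set)"
  shows "real D ^ CARD('n) \<le> real (card K) * real M ^ CARD('n)"
proof -
  let ?n = "CARD('n)" and ?q = "CARD('a)" and ?g = "card (Gr r :: ('a ^ 'n) set set)"
    and ?A = "card (directions r K)"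
  have "?A > 0" using assms(2) by (simp add: card_gt_0_iff)
  then have "D > 0" "M > 0" by (simp_all add: D_def M_def)
  have bound: "real D ^ ?n \<le> real (card K) * (real M + real ?n * inverse (real (Suc N))) ^ ?n" for N
  proof -
    \<comment> \<open>The three values make both numerical hypotheses of
      \<open>card_exponents_le\<close> equalities, at every scale \<open>Suc N\<close>.\<close>
    define d where "d = Suc N * D"
    define m where "m = Suc N * M"
    define l where "l = Suc N * (?q * ?g)"
    have "d > 0" "m > 0" using \<open>D > 0\<close> \<open>M > 0\<close> by (simp_all add: d_def m_def)
    have 1: "d + (?q - 1) * l \<le> ?q * m"
    proof -
      have "D + (?q - 1) * (?q * ?g) = ?q * M" by (simp add: D_def M_def algebra_simps)
      then have "Suc N * (D + (?q - 1) * (?q * ?g)) = Suc N * (?q * M)" by simp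
      then show ?thesis by (simp only: d_def l_def m_def add_mult_distrib2 mult_ac)
    qed
    have 2: "d * ?g \<le> ?q ^ r * l * ?A"
      by (simp only: d_def l_def D_def power_add power_one_right mult_ac)
    have "card {e :: 'n \<Rightarrow> nat. sum e UNIV < d} \<le> card K * card {e :: 'n \<Rightarrow> nat. sum e UNIV < m}"
      by (rule card_exponents_le[OF assms(1) 1 2])
    then have *: "(d + ?n - 1) choose ?n \<le> card K * ((m + ?n - 1) choose ?n)"
      by (simp only: card_bounded_exponents \<open>d > 0\<close> \<open>m > 0\<close>)
    have "d ^ ?n \<le> fact ?n * ((d + ?n - 1) choose ?n)"
      by (rule power_le_fact_times_binomial[OF \<open>d > 0\<close>])
    also have "\<dots> \<le> fact ?n * (card K * ((m + ?n - 1) choose ?n))"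
      using * by (rule mult_le_mono2)
    also have "\<dots> = card K * (((m + ?n - 1) choose ?n) * fact ?n)" by (simp only: mult_ac)
    also have "\<dots> \<le> card K * (m + ?n - 1) ^ ?n"
      by (rule mult_le_mono2[OF binomial_fact_pow])
    also have "\<dots> \<le> card K * (m + ?n) ^ ?n"
      by (intro mult_le_mono2 power_mono) auto
    finally have "real (d ^ ?n) \<le> real (card K * (m + ?n) ^ ?n)" by (rule of_nat_mono)
    then have "real (Suc N) ^ ?n * real D ^ ?n \<le> real (card K) * (real (Suc N) * real M + real ?n) ^ ?n"
      by (simp only: d_def m_def of_nat_mult of_nat_power of_nat_add power_mult_distrib)
    also have "real (Suc N) * real M + real ?n =
        real (Suc N) * (real M + real ?n * inverse (real (Suc N)))"
      by (simp add: field_simps)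
    finally have "real (Suc N) ^ ?n * real D ^ ?n \<le>
        real (Suc N) ^ ?n * (real (card K) * (real M + real ?n * inverse (real (Suc N))) ^ ?n)"
      by (simp only: power_mult_distrib mult_ac)
    then show ?thesis by (subst (asm) mult_le_cancel_left_pos) auto
  qed
  \<comment> \<open>The error from comparing binomial coefficients with powers disappears in the
    limit.\<close>
  have "(\<lambda>N. real (card K) * (real M + real ?n * inverse (real (Suc N))) ^ ?n) \<longlonglongrightarrow>
      real (card K) * (real M + real ?n * 0) ^ ?n"
    by (intro tendsto_intros LIMSEQ_inverse_real_of_nat)
  then show ?thesis
    using bound by (intro LIMSEQ_le_const[where X = "\<lambda>N. real (card K) *
      (real M + real ?n * inverse (real (Suc N))) ^ ?n"]) auto
qed

text \<open>The bound increases strictly with the density, so a density strictly above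
  \<open>\<delta>\<close> gives a strict inequality.\<close>

corollary partial_Kakeya_bound:
  fixes K :: "('a::{field,finite} ^ 'n) set" and \<delta> :: real
  assumes "r \<le> CARD('n)" "0 < \<delta>"
    and \<delta>: "\<delta> * card (Gr r :: ('a ^ 'n) set set) < card (directions r K)"
  shows "(CARD('a) / (1 + (real CARD('a) - 1) / (\<delta> * CARD('a) ^ r))) ^ CARD('n) < card K"
proof -
  let ?n = "CARD('n)" and ?q = "CARD('a)" and ?g = "card (Gr r :: ('a ^ 'n) set set)"
    and ?A = "card (directions r K)"
  have "card {0, 1 :: 'a} \<le> ?q" by (intro card_mono) auto
  then have q: "?q \<ge> 2" by simp
  define D where "D = ?q ^ (r + 1) * ?A"
  define M where "M = ?q ^ r * ?A + (?q - 1) * ?g"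
  have "0 \<le> \<delta> * ?g" using assms(2) by simp
  with \<delta> have "real ?A > 0" by linarith
  then have A: "directions r K \<noteq> {}" by auto
  have M: "real M > 0" using \<open>real ?A > 0\<close> q by (simp add: M_def add_pos_nonneg)
  have le: "real D ^ ?n \<le> real (card K) * real M ^ ?n"
    unfolding D_def M_def by (rule partial_Kakeya_bound_nat[OF assms(1) A])
  have X: "1 + (real ?q - 1) / (\<delta> * ?q ^ r) > 0"
    using q assms(2) by (intro add_pos_nonneg divide_nonneg_nonneg) auto
  have "?q / (1 + (real ?q - 1) / (\<delta> * ?q ^ r)) < D / M"
  proof -
    have "real D = real ?q * (real ?q ^ r * ?A)" by (simp add: D_def)
    moreover have "real M < (real ?q ^ r * ?A) * (1 + (real ?q - 1) / (\<delta> * ?q ^ r))"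
    proof -
      have "real M = real ?q ^ r * ?A + (real ?q - 1) * ?g"
        using q by (simp add: M_def of_nat_diff)
      moreover have "(real ?q - 1) * ?g < (real ?q - 1) * (?A / \<delta>)"
        using \<delta> assms(2) q by (intro mult_strict_left_mono) (auto simp: field_simps)
      moreover have "(real ?q ^ r * ?A) * (1 + (real ?q - 1) / (\<delta> * ?q ^ r)) =
          real ?q ^ r * ?A + (real ?q - 1) * (?A / \<delta>)"
        using q assms(2) by (simp add: field_simps)
      ultimately show ?thesis by linarith
    qed
    then have "real ?q * real M < real ?q * ((real ?q ^ r * ?A) * (1 + (real ?q - 1) / (\<delta> * ?q ^ r)))"
      using q by (intro mult_strict_left_mono) auto
    ultimately show ?thesis using X M by (simp add: divide_less_eq less_divide_eq mult_ac)
  qed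
  then have "(?q / (1 + (real ?q - 1) / (\<delta> * ?q ^ r))) ^ ?n < (D / M) ^ ?n"
    using X by (intro power_strict_mono) auto
  also have "\<dots> \<le> card K" using le M by (simp add: power_divide divide_le_eq)
  finally show ?thesis .
qed

text \<open>The union of \<open>t\<close> images misses less than a fraction
  \<open>1 - \<delta>\<close> of the directions, so the bound for density \<open>\<delta>\<close>
  applies to it; its size is at most \<open>t * card K\<close>.\<close>

lemma amplified_Kakeya_bound:
  fixes K :: "('a::{field,finite} ^ 'n) set" and \<epsilon> \<delta> :: real
  assumes "eps_Kakeya \<epsilon> r K" "\<epsilon> < 1" "r \<le> CARD('n)" "0 < \<delta>" "(1 - \<epsilon>) ^ t < 1 - \<delta>"
  shows "(CARD('a) / (1 + (real CARD('a) - 1) / (\<delta> * CARD('a) ^ r))) ^ CARD('n) < real t * card K"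
proof -
  let ?g = "card (Gr r :: ('a ^ 'n) set set)"
  have "\<epsilon> * ?g \<le> card (directions r K)"
    using assms(1) by (simp add: eps_Kakeya_def directions_def)
  then obtain L :: "('a ^ 'n) set" where L: "card L \<le> t * card K"
    "card (Gr r - directions r L) \<le> (1 - \<epsilon>) ^ t * ?g"
    using amplify_directions[of \<epsilon> r K t] assms(2) by auto
  have sub: "directions r L \<subseteq> Gr r" by (auto simp: directions_def)
  then have "real (card (Gr r - directions r L)) = real ?g - card (directions r L)"
    by (simp add: card_Diff_subset card_mono of_nat_diff)
  moreover obtain S :: "('a ^ 'n) set" where "S \<in> Gr r"
    using subset_of_Gr[of "{}" r] assms(3) by auto
  then have "?g > 0" by (auto simp: card_gt_0_iff)
  then have "(1 - \<epsilon>) ^ t * ?g < (1 - \<delta>) * ?g" using assms(5) by simp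
  ultimately have "\<delta> * ?g < card (directions r L)" using L(2) by (simp add: algebra_simps)
  from partial_Kakeya_bound[OF assms(3,4) this] show ?thesis
    using of_nat_mono[OF L(1), where 'a = real] by simp
qed

theorem theorem2p8:
  fixes q n r :: nat and \<epsilon> :: real and K :: "('a::{field,finite} ^ 'n) set"
  assumes "CARD('a) = q" and "CARD('n) = n"
    and "r \<in> {1..n - 1}" and "0 < \<epsilon>" and "\<epsilon> < 1"
    and "eps_Kakeya \<epsilon> r K"
  shows "real (card K)
           > \<epsilon> * (1 + 2 * (real q - 1) * real q powi (- int r)) powi (- int n) * real q ^ n
       \<and> (r = 1 \<longrightarrow>
           real (card K)
             > \<epsilon> * (exp (- 1) / ln (2 * exp 1 * real n)) * 2 powi (- int n) * real q ^ n)"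
proof (intro conjI impI)
  have n: "n \<ge> 2" and r: "r \<le> CARD('n)" using assms(2,3) by auto
  have "card {0, 1 :: 'a} \<le> CARD('a)" by (intro card_mono) auto
  then have q: "q \<ge> 2" using assms(1) by simp
  have amplified: "(q / (1 + (real q - 1) / (\<delta> * q ^ r))) ^ n < real t * card K"
    if "0 < \<delta>" "(1 - \<epsilon>) ^ t < 1 - \<delta>" for \<delta> :: real and t
    using amplified_Kakeya_bound[OF assms(6,5) r that] assms(1,2) by simp
  show "real (card K) > \<epsilon> * (1 + 2 * (real q - 1) * real q powi (- int r)) powi (- int n) * real q ^ n"
  proof -
    \<comment> \<open>Rounding down keeps the cost \<open>t\<close> of the union at most
      \<open>1 / \<epsilon>\<close>, while \<open>1 / \<epsilon> < t + 1\<close> and Bernoulli's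
      inequality still leave less than half of the directions missed.\<close>
    define t where "t = nat \<lfloor>1 / \<epsilon>\<rfloor>"
    have "1 / \<epsilon> \<ge> 1" using assms(4,5) by simp
    then have t: "t \<ge> 1" "real t \<le> 1 / \<epsilon>" "1 / \<epsilon> < real t + 1"
      unfolding t_def by linarith+
    have "1 - \<epsilon> < real t / (real t + 1)" using t(3) assms(4) by (simp add: field_simps)
    then have "(1 - \<epsilon>) ^ t < (real t / (real t + 1)) ^ t"
      using t(1) assms(5) by (intro power_strict_mono) auto
    also have "\<dots> \<le> 1 / 2"
    proof -
      have "2 \<le> (1 + 1 / real t) ^ t"
        using Bernoulli_inequality[OF order_trans[of "-1" 0 "1 / real t"], of t] t(1) by simp
      also have "1 + 1 / real t = (real t + 1) / real t" using t(1) by (simp add: field_simps)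
      finally show ?thesis using t(1) by (simp add: power_divide field_simps)
    qed
    finally have "(q / (1 + (real q - 1) / (1 / 2 * q ^ r))) ^ n < real t * card K"
      by (intro amplified) auto
    also have "\<dots> \<le> card K / \<epsilon>" using mult_right_mono[OF t(2), of "card K"] by simp
    finally have "\<epsilon> * (q / (1 + (real q - 1) / (1 / 2 * q ^ r))) ^ n < card K"
      using assms(4) by (simp add: field_simps)
    moreover have "(real q - 1) / (1 / 2 * q ^ r) = 2 * (real q - 1) * real q powi (- int r)"
      by (simp add: power_int_minus field_simps)
    moreover have "(x / y) ^ n = y powi (- int n) * x ^ n" for x y :: real
      by (simp add: power_int_minus power_divide inverse_eq_divide)
    ultimately show ?thesis by (simp only: mult.assoc)
  qed
  assume "r = 1"
  show "real (card K) > \<epsilon> * (exp (- 1) / ln (2 * exp 1 * real n)) * 2 powi (- int n) * real q ^ n"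
  proof -
    \<comment> \<open>Chosen so that \<open>exp (- c) = 2 / (n + 2)\<close>, the fraction missed
      when \<open>\<delta> = n / (n + 2)\<close>.\<close>
    define c where "c = ln ((real n + 2) / 2)"
    have "c > 0" using n by (simp add: c_def)
    define t where "t = nat \<lceil>c / \<epsilon>\<rceil>"
    have "c / \<epsilon> > 0" using \<open>c > 0\<close> assms(4) by simp
    then have t: "t > 0" "c / \<epsilon> \<le> real t" "real t < c / \<epsilon> + 1"
      unfolding t_def by linarith+
    have "(1 - \<epsilon>) ^ t < exp (- \<epsilon>) ^ t"
      using exp_minus_greater[of \<epsilon>] assms(4,5) t(1) by (intro power_strict_mono) auto
    also have "\<dots> = exp (- (\<epsilon> * real t))" by (simp add: exp_of_nat_mult[symmetric] mult.commute)
    also have "\<dots> \<le> exp (- c)" using t(2) assms(4) by (simp add: field_simps)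
    also have "\<dots> = 1 - real n / (real n + 2)"
      by (simp add: c_def exp_minus field_simps)
    finally have less: "(q / (1 + (real q - 1) / (real n / (real n + 2) * q ^ r))) ^ n < real t * card K"
      using n by (intro amplified) auto
    \<comment> \<open>For \<open>r = 1\<close> the denominator exceeds 2 by a factor of at most
      \<open>1 + 1 / n\<close>, whose \<open>n\<close>-th power costs only
      \<open>exp 1\<close>.\<close>
    have "1 + (real q - 1) / (real n / (real n + 2) * q ^ r) \<le> 2 * (1 + 1 / real n)"
    proof -
      have "(real q - 1) / q \<le> 1" using q by simp
      then have "(real q - 1) / q * ((real n + 2) / real n) \<le> 1 * ((real n + 2) / real n)"
        by (intro mult_right_mono) auto
      moreover have "(real q - 1) / (real n / (real n + 2) * q ^ r) =
          (real q - 1) / q * ((real n + 2) / real n)"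
        using \<open>r = 1\<close> by simp
      moreover have "1 + 1 * ((real n + 2) / real n) = 2 * (1 + 1 / real n)"
        using n by (simp add: field_simps)
      ultimately show ?thesis by linarith
    qed
    then have "(q / (2 * (1 + 1 / real n))) ^ n \<le>
        (q / (1 + (real q - 1) / (real n / (real n + 2) * q ^ r))) ^ n"
      using q n by (intro power_mono divide_left_mono mult_pos_pos add_pos_nonneg) auto
    with less have less: "(q / (2 * (1 + 1 / real n))) ^ n < real t * card K" by linarith
    have "(1 + 1 / real n) ^ n \<le> exp 1"
      using exp_ge_one_plus_x_over_n_power_n[of n 1] n by simp
    then have "real q ^ n / (2 ^ n * exp 1) \<le> real q ^ n / (2 ^ n * (1 + 1 / real n) ^ n)"
      by (intro divide_left_mono mult_left_mono mult_pos_pos) (auto simp: add_pos_nonneg)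
    also have "\<dots> = (q / (2 * (1 + 1 / real n))) ^ n"
      by (simp only: power_divide power_mult_distrib)
    also note less
    also have "real t * card K \<le> ln (2 * exp 1 * real n) / \<epsilon> * card K"
    proof (intro mult_right_mono)
      \<comment> \<open>Rounding up adds less than 1, which is less than
        \<open>1 / \<epsilon>\<close>; the extra 1 beside \<open>c\<close> becomes the factor
        \<open>exp 1\<close> inside the logarithm.\<close>
      have "real t \<le> (c + 1) / \<epsilon>"
        using t(3) assms(4,5) by (simp add: field_simps)
      also have "c + 1 = ln ((real n + 2) / 2 * exp 1)"
        unfolding c_def by (subst ln_mult) auto
      also have "\<dots> / \<epsilon> \<le> ln (2 * exp 1 * real n) / \<epsilon>"
      proof (intro divide_right_mono)
        have "(real n + 2) / 2 * exp 1 \<le> (2 * real n) * exp 1"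
          using n by (intro mult_right_mono) auto
        then show "ln ((real n + 2) / 2 * exp 1) \<le> ln (2 * exp 1 * real n)"
          by (intro ln_mono) (auto simp: mult_ac add_pos_nonneg)
      qed (use assms(4) in simp)
      finally show "real t \<le> ln (2 * exp 1 * real n) / \<epsilon>" .
    qed simp
    finally have *: "real q ^ n / (2 ^ n * exp 1) < ln (2 * exp 1 * real n) / \<epsilon> * card K" .
    have "1 \<le> exp (1 :: real)" by simp
    then have "1 * 2 < 2 * exp 1 * real n"
      using n mult_mono[of 1 "exp 1" 2 "real n"] by simp
    then have "ln (2 * exp 1 * real n) > 0" by (intro ln_gt_zero) simp
    with * assms(4) show ?thesis
      by (simp add: power_int_minus exp_minus field_simps)
  qed
qed

end
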